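(* Let $k$ be a field and let $n_1,n_2,n_3,n_4$ be positive integers with $\gcd(n_1,n_2,n_3,n_4)=1$ that form a minimal generating system of the numerical semigroup $S=\langle n_1,n_2,n_3,n_4\rangle$. Let $\mathcal C\subseteq\mathbb A^4$ be the monomial curve parametrized by $(t^{n_1},t^{n_2},t^{n_3},t^{n_4})$, with associated local ring $R=k[[t^{n_1},t^{n_2},t^{n_3},t^{n_4}]]$. If $\mathcal C$ is almost Gorenstein, then the Cohen-Macaulay type of $\mathcal C$ is at most $3$.
   Context: $\mathbb N$ denotes the nonnegative integers. The numerical semigroup generated by positive integers $n_1,\dots,n_e$ with $\gcd(n_1,\dots,n_e)=1$ is $S=\langle n_1,\dots,n_e\rangle=\{a_1n_1+\cdots+a_en_e : a_i\in\mathbb N\}$; $\{n_1,\dots,n_e\}$ is a minimal generating system if no $n_i$ lies in the semigroup generated by the others. The ring $R=k[[t^{n_1},\dots,t^{n_4}]]$ (a subring of $k[[t]]$) is a one-dimensional Cohen-Macaulay local domain with maximal ideal $\mathfrak m$ and normalization $\overline R=k[[t]]$. The Cohen-Macaulay type of $\mathcal C$ is that of $R$, i.e. $\dim_k \operatorname{Ext}^1_R(k,R)$. The curve $\mathcal C$ is almost Gorenstein if $R$ is almost Gorenstein in the sense of Barucci and Fröberg: for a canonical fractional ideal $\omega$ of $R$ with $R\subseteq\omega\subseteq\overline R$ one has $\mathfrak m\,\omega\subseteq\mathfrak m$. Semigroup dictionary (standard): let $F(S)=\max(\mathbb Z\setminus S)$ and $PF(S)=\{x\in\mathbb Z\setminus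 S : x+s\in S \text{ for every } s\in S\setminus\{0\}\}$, and let $t(S)=|PF(S)|$ be the type of $S$. The semigroup $S$ is almost symmetric if for every $x\in\mathbb Z\setminus S$ with $F(S)-x\notin S$ one has $\{x,F(S)-x\}\subseteq PF(S)$. Then $R$ is almost Gorenstein if and only if $S$ is almost symmetric, and the Cohen-Macaulay type of $R$ equals $t(S)$. So the theorem is equivalent to: if $S$ is an almost symmetric numerical semigroup minimally generated by $4$ elements, then $t(S)\le 3$. *)

theory Defs
  imports
    "HOL-Computational_Algebra.Formal_Laurent_Series"
    "HOL-Library.Extended_Nat"
    "Jordan_Normal_Form.Missing_VectorSpace"
    "HOL-Algebra.QuotRing"
begin

section \<open>Numerical semigroups\<close>

text \<open>The generators form a family \<open>n\<close> indexed by a finite set \<open>I\<close>, so that repeated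
  generators are not silently identified.\<close>

definition generated_semigroup :: "('i \<Rightarrow> nat) \<Rightarrow> 'i set \<Rightarrow> nat set" where
  "generated_semigroup n I = {\<Sum>i\<in>I. a i * n i | a. True}"

definition minimal_generating_system :: "('i \<Rightarrow> nat) \<Rightarrow> 'i set \<Rightarrow> bool" where
  "minimal_generating_system n I \<longleftrightarrow> (\<forall>i\<in>I. n i \<notin> generated_semigroup n (I - {i}))"


section \<open>Modules and the first Ext module\<close>

text \<open>A module record also carries the multiplicative fields of a ring record. They play no
  role for modules; below they are filled with dummy values where no product is available.\<close>

text \<open>The ring \<open>R\<close> as a module over itself, or over any of its subrings.\<close>

definition regular_module :: "('a, 'm) ring_scheme \<Rightarrow> ('a, 'a) module" where
  "regular_module R =
     \<lparr>carrier = carrier R, mult = mult R, one = one R, zero = zero R, add = add R,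
      smult = mult R\<rparr>"

definition quotient_module ::
  "('a, 'b, 'm) module_scheme \<Rightarrow> 'b set \<Rightarrow> ('a, 'b set) module" where
  "quotient_module M H =
     \<lparr>carrier = a_rcosets\<^bsub>M\<^esub> H, mult = (\<lambda>_ _. H), one = H, zero = H, add = set_add M,
      smult = (\<lambda>r X. \<Union>x\<in>X. H +>\<^bsub>M\<^esub> (r \<odot>\<^bsub>M\<^esub> x))\<rparr>"

definition restrict_scalars ::
  "('c \<Rightarrow> 'a) \<Rightarrow> ('a, 'b, 'm) module_scheme \<Rightarrow> ('c, 'b) module" where
  "restrict_scalars h M =
     \<lparr>carrier = carrier M, mult = mult M, one = one M, zero = zero M, add = add M,
      smult = (\<lambda>c x. h c \<odot>\<^bsub>M\<^esub> x)\<rparr>"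

text \<open>\<open>Hom\<^sub>R(M, N)\<close>; homomorphisms are made extensional, so that equal maps on the carrier
  of \<open>M\<close> are equal.\<close>

definition hom_module ::
  "('a, 'r) ring_scheme \<Rightarrow> ('a, 'b, 'm) module_scheme \<Rightarrow> ('a, 'c, 'n) module_scheme
    \<Rightarrow> ('a, 'b \<Rightarrow> 'c) module" where
  "hom_module R M N =
     \<lparr>carrier = module_hom R M N \<inter> extensional (carrier M),
      mult = (\<lambda>_ _. \<lambda>x\<in>carrier M. \<zero>\<^bsub>N\<^esub>), one = (\<lambda>x\<in>carrier M. \<zero>\<^bsub>N\<^esub>),
      zero = (\<lambda>x\<in>carrier M. \<zero>\<^bsub>N\<^esub>),
      add = (\<lambda>f g. \<lambda>x\<in>carrier M. f x \<oplus>\<^bsub>N\<^esub> g x),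
      smult = (\<lambda>r f. \<lambda>x\<in>carrier M. r \<odot>\<^bsub>N\<^esub> f x)\<rparr>"

text \<open>The free module \<open>R\<^sup>(\<^sup>X\<^sup>)\<close> of finitely supported functions on \<open>X\<close>.\<close>

definition free_module :: "('a, 'r) ring_scheme \<Rightarrow> 'i set \<Rightarrow> ('a, 'i \<Rightarrow> 'a) module" where
  "free_module R X =
     \<lparr>carrier = {f \<in> X \<rightarrow>\<^sub>E carrier R. finite {x \<in> X. f x \<noteq> \<zero>\<^bsub>R\<^esub>}},
      mult = (\<lambda>_ _. \<lambda>x\<in>X. \<zero>\<^bsub>R\<^esub>), one = (\<lambda>x\<in>X. \<zero>\<^bsub>R\<^esub>),
      zero = (\<lambda>x\<in>X. \<zero>\<^bsub>R\<^esub>),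
      add = (\<lambda>f g. \<lambda>x\<in>X. f x \<oplus>\<^bsub>R\<^esub> g x),
      smult = (\<lambda>r f. \<lambda>x\<in>X. r \<otimes>\<^bsub>R\<^esub> f x)\<rparr>"

text \<open>The canonical surjection onto \<open>M\<close> from the free module on the elements of \<open>M\<close>, and the
  first syzygy module of \<open>M\<close>, which is its kernel.\<close>

definition free_cover ::
  "('a, 'r) ring_scheme \<Rightarrow> ('a, 'b, 'm) module_scheme \<Rightarrow> ('b \<Rightarrow> 'a) \<Rightarrow> 'b" where
  "free_cover R M f = (\<Oplus>\<^bsub>M\<^esub>x\<in>{x \<in> carrier M. f x \<noteq> \<zero>\<^bsub>R\<^esub>}. f x \<odot>\<^bsub>M\<^esub> x)"

definition syzygy_module ::
  "('a, 'r) ring_scheme \<Rightarrow> ('a, 'b, 'm) module_scheme \<Rightarrow> ('a, 'b \<Rightarrow> 'a) module" where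
  "syzygy_module R M = (free_module R (carrier M))
     \<lparr>carrier := {f \<in> carrier (free_module R (carrier M)). free_cover R M f = \<zero>\<^bsub>M\<^esub>}\<rparr>"

text \<open>With \<open>0 \<rightarrow> K \<rightarrow> F \<rightarrow> M \<rightarrow> 0\<close> the free cover \<open>F\<close> of \<open>M\<close> and its kernel \<open>K\<close>, the module
  \<open>Ext\<^sup>1\<^sub>R(M, N)\<close> is the cokernel of the restriction map \<open>Hom\<^sub>R(F, N) \<rightarrow> Hom\<^sub>R(K, N)\<close>.\<close>

definition Ext1 ::
  "('a, 'r) ring_scheme \<Rightarrow> ('a, 'b, 'm) module_scheme \<Rightarrow> ('a, 'c, 'n) module_scheme
    \<Rightarrow> ('a, (('b \<Rightarrow> 'a) \<Rightarrow> 'c) set) module" where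
  "Ext1 R M N =
     quotient_module (hom_module R (syzygy_module R M) N)
       ((\<lambda>f. restrict f (carrier (syzygy_module R M))) `
          carrier (hom_module R (free_module R (carrier M)) N))"

text \<open>\<open>vectorspace.dim\<close> is only meaningful for finite-dimensional spaces.\<close>

definition vdim :: "('a, 'r) ring_scheme \<Rightarrow> ('a, 'b, 'm) module_scheme \<Rightarrow> enat" where
  "vdim K V = (if vectorspace.fin_dim K V then enat (vectorspace.dim K V) else \<infinity>)"


section \<open>Type and almost Gorenstein property of a local ring\<close>

definition max_ideal :: "('a, 'r) ring_scheme \<Rightarrow> 'a set" where
  "max_ideal R = (THE M. maximalideal M R)"

text \<open>The type of a one-dimensional Cohen-Macaulay local ring \<open>R\<close> which contains its residue
  field: \<open>h\<close> embeds the field \<open>K\<close> into \<open>R\<close> as a coefficient field, and the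
  \<open>R\<close>-module \<open>Ext\<^sup>1\<^sub>R(R/\<mm>, R)\<close> is regarded as a vector space over \<open>K\<close> via \<open>h\<close>.\<close>

definition CM_type ::
  "('k, 's) ring_scheme \<Rightarrow> ('k \<Rightarrow> 'a) \<Rightarrow> ('a, 'r) ring_scheme \<Rightarrow> enat" where
  "CM_type K h R =
     vdim K (restrict_scalars h
       (Ext1 R (quotient_module (regular_module R) (max_ideal R)) (regular_module R)))"

text \<open>From here on, \<open>A\<close> is a subring of the field \<open>Q\<close>, and \<open>Q\<close> is its field of fractions.\<close>

definition fractional_ideal :: "('a, 'r) ring_scheme \<Rightarrow> 'a set \<Rightarrow> 'a set \<Rightarrow> bool" where
  "fractional_ideal Q A I \<longleftrightarrow>
     submodule (Q\<lparr>carrier := A\<rparr>) I (regular_module Q) \<and> I \<noteq> {\<zero>\<^bsub>Q\<^esub>} \<and>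
     (\<exists>d\<in>A - {\<zero>\<^bsub>Q\<^esub>}. \<forall>x\<in>I. d \<otimes>\<^bsub>Q\<^esub> x \<in> A)"

definition colon :: "('a, 'r) ring_scheme \<Rightarrow> 'a set \<Rightarrow> 'a set \<Rightarrow> 'a set" where
  "colon Q I J = {x \<in> carrier Q. \<forall>y\<in>J. x \<otimes>\<^bsub>Q\<^esub> y \<in> I}"

text \<open>Canonical fractional ideals in the sense of Herzog and Kunz, which is the definition
  used by Barucci and Froeberg.\<close>

definition canonical_ideal :: "('a, 'r) ring_scheme \<Rightarrow> 'a set \<Rightarrow> 'a set \<Rightarrow> bool" where
  "canonical_ideal Q A \<omega> \<longleftrightarrow>
     fractional_ideal Q A \<omega> \<and>
     (\<forall>I. fractional_ideal Q A I \<longrightarrow> colon Q \<omega> (colon Q \<omega> I) = I)"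

text \<open>\<open>B\<close> is the normalization of \<open>A\<close>. Any two canonical ideals between \<open>A\<close> and \<open>B\<close> differ by
  a unit of \<open>B\<close>, and the condition does not depend on the choice of \<open>\<omega>\<close>.\<close>

definition almost_Gorenstein ::
  "('a, 'r) ring_scheme \<Rightarrow> 'a set \<Rightarrow> 'a set \<Rightarrow> bool" where
  "almost_Gorenstein Q A B \<longleftrightarrow>
     (\<exists>\<omega>. canonical_ideal Q A \<omega> \<and> A \<subseteq> \<omega> \<and> \<omega> \<subseteq> B \<and>
       (\<forall>a\<in>max_ideal (Q\<lparr>carrier := A\<rparr>). \<forall>w\<in>\<omega>.
          a \<otimes>\<^bsub>Q\<^esub> w \<in> max_ideal (Q\<lparr>carrier := A\<rparr>)))"


section \<open>Local rings of monomial curves\<close>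

definition type_ring :: "'k::comm_ring_1 ring" where
  "type_ring = \<lparr>carrier = UNIV, mult = (*), one = 1, zero = 0, add = (+)\<rparr>"

text \<open>The subring \<open>k[[t]]\<close> of \<open>k((t))\<close>.\<close>

definition power_series :: "'k::field fls set" where
  "power_series = range fps_to_fls"

text \<open>The subring of \<open>k[[t]]\<close> generated as a power series ring by the \<open>t\<^sup>n\<^sup>i\<close>, i.e. the image
  of the substitution \<open>x\<^sub>i \<mapsto> t\<^sup>n\<^sup>i\<close> from the ring of formal power series in the variables \<open>x\<^sub>i\<close>,
  \<open>i \<in> I\<close>. A power series in these variables is given by its coefficients \<open>c a\<close> at the
  monomials with exponent vector \<open>a\<close>. The inner sum is finite if all \<open>n i\<close> are positive.\<close>

definition monomial_power_series :: "('i \<Rightarrow> nat) \<Rightarrow> 'i set \<Rightarrow> 'k::field fls set" where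
  "monomial_power_series n I =
     {fps_to_fls (Abs_fps (\<lambda>d. \<Sum>a\<in>{a \<in> I \<rightarrow>\<^sub>E UNIV. (\<Sum>i\<in>I. a i * n i) = d}. c a)) | c.
        True}"

text \<open>The monomial curve with parametrization \<open>(t\<^sup>n\<^sup>i)\<^sub>i\<close> over the field \<open>'k\<close> enters through its
  local ring. For \<open>gcd\<close> one, the field of fractions of that ring is \<open>k((t))\<close> and
  its normalization is \<open>k[[t]]\<close>.\<close>

definition curve_almost_Gorenstein :: "'k::field itself \<Rightarrow> ('i \<Rightarrow> nat) \<Rightarrow> 'i set \<Rightarrow> bool" where
  "curve_almost_Gorenstein _ n I \<longleftrightarrow>
     almost_Gorenstein (type_ring :: 'k fls ring) (monomial_power_series n I) power_series"

definition curve_CM_type :: "'k::field itself \<Rightarrow> ('i \<Rightarrow> nat) \<Rightarrow> 'i set \<Rightarrow> enat" where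
  "curve_CM_type _ n I =
     CM_type (type_ring :: 'k ring) fls_const
       ((type_ring :: 'k fls ring)\<lparr>carrier := monomial_power_series n I\<rparr>)"

end

theory Submission
  imports Defs
begin

unbundle fps_syntax

text \<open>
  Let \<open>S\<close> be the semigroup, \<open>F\<close> its largest gap, \<open>PF\<close> the set of its pseudo-Frobenius numbers
  (which contains \<open>F\<close>), and \<open>P = PF - {F}\<close>. Write \<open>\<mm>\<close> for the maximal ideal of the local ring
  \<open>R\<close>, which consists of the power series with all exponents in \<open>S\<close>. The bound rests on three
  facts.

  \<^item> The type of \<open>R\<close> is at most \<open>|PF|\<close> (\<open>CM_type_le\<close>). Let \<open>K\<close> be the kernel of the free cover of
    the residue field. Since \<open>\<mm>\<close> maps the free cover into \<open>K\<close>, a homomorphism \<open>K \<rightarrow> R\<close> extends to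
    the free cover with values in \<open>k((t))\<close>. Its class in \<open>Ext\<^sup>1\<close> vanishes if the extension takes a
    value in \<open>R\<close> on the basis vector \<open>e\<close> over the residue class of 1, and the value on \<open>e\<close>
    is multiplied by \<open>\<mm>\<close> into \<open>R\<close>. So its exponents lie in \<open>S \<union> PF\<close>, and its \<open>|PF|\<close>
    coefficients at the exponents in \<open>PF\<close> determine the class.

  \<^item> If \<open>R\<close> is almost Gorenstein, then \<open>f \<mapsto> F - f\<close> maps \<open>P\<close> to itself
    (\<open>almost_Gorenstein_imp_symmetric\<close>). Take a canonical ideal \<open>\<omega>\<close> with
    \<open>R \<subseteq> \<omega> \<subseteq> k[[t]]\<close> and \<open>\<mm>\<omega> \<subseteq> \<mm>\<close>. The dual of \<open>R + t\<^sup>xk[[t]]\<close> with respect to \<open>\<omega>\<close> consists of the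
    elements of \<open>\<omega>\<close> of order at least \<open>F + 1 - x\<close>. These modules change from \<open>x\<close> to \<open>x + 1\<close> when \<open>x\<close>
    is a gap, and hence so do their duals: \<open>\<omega>\<close> contains an element of order \<open>F - x\<close>. Multiplication
    of this element by \<open>t\<^sup>s \<in> \<mm>\<close> shows \<open>F - x + s \<in> S\<close> for all \<open>s \<in> S - {0}\<close>. For \<open>x \<in> P\<close> the
    number \<open>F - x\<close> is itself a gap, since \<open>x + (F - x) \<notin> S\<close>, and hence an element of \<open>P\<close>.

  \<^item> With four generators, this symmetry forces \<open>|P| \<le> 2\<close> (\<open>card_le_2\<close>), by double counting. For
    \<open>f \<in> P\<close> and an ordered pair \<open>i \<noteq> j\<close> of indices, at most one of
    \<open>f + n\<^sub>i - n\<^sub>j \<in> S\<close>, \<open>(F - f) + n\<^sub>j - n\<^sub>i \<in> S\<close> and \<open>f + n\<^sub>i - n\<^sub>j \<in> P\<close> holds. There are 12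
    pairs. For fixed \<open>f\<close> and \<open>i\<close> the first case occurs for some \<open>j\<close>, because \<open>f + n\<^sub>i \<in> S\<close> and
    \<open>f \<notin> S\<close>. Let \<open>r(f)\<close> count the \<open>i\<close> for which it occurs for a single \<open>j\<close>, and let \<open>N(f)\<close> count
    the pairs of the third kind. Then
    \<open>(8 - r(f)) + (8 - r(F - f)) + N(f) \<le> 12\<close>. When \<open>j\<close> is the only partner of \<open>i\<close>,
    the sum \<open>f + n\<^sub>i\<close> is a multiple of \<open>n\<^sub>j\<close>, and it is always the same multiple. So if \<open>d\<^sub>j\<close>
    indices \<open>i\<close> have single partner \<open>j\<close> (each for some \<open>f\<close>), then any two of them give a pair of
    the third kind, and \<open>\<Sum>\<^sub>f N(f) \<ge> \<Sum>\<^sub>j d\<^sub>j(d\<^sub>j - 1)\<close>, while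
    \<open>\<Sum>\<^sub>f r(f) \<le> \<Sum>\<^sub>j d\<^sub>j\<close>. Summation over \<open>f\<close> yields
    \<open>4|P| \<le> \<Sum>\<^sub>j (2d\<^sub>j - d\<^sub>j(d\<^sub>j - 1)) \<le> 4 \<cdot> 2\<close>.
\<close>

section \<open>Numerical semigroups\<close>

definition pseudo_frobenius :: "nat set \<Rightarrow> nat set" where
  "pseudo_frobenius S = {x. x \<notin> S \<and> (\<forall>s\<in>S - {0}. x + s \<in> S)}"

lemma generated_semigroup_zero: "0 \<in> generated_semigroup n I"
  unfolding generated_semigroup_def by (auto intro!: exI[of _ "\<lambda>_. 0"])

lemma generated_semigroup_add:
  assumes "x \<in> generated_semigroup n I" "y \<in> generated_semigroup n I"
  shows "x + y \<in> generated_semigroup n I"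
proof -
  obtain a b where "x = (\<Sum>i\<in>I. a i * n i)" "y = (\<Sum>i\<in>I. b i * n i)"
    using assms unfolding generated_semigroup_def by auto
  then have "x + y = (\<Sum>i\<in>I. (a i + b i) * n i)"
    by (simp add: sum.distrib distrib_right)
  then show ?thesis
    unfolding generated_semigroup_def by (auto intro!: exI[of _ "\<lambda>i. a i + b i"])
qed

lemma generated_semigroup_generator:
  assumes "finite I" "i \<in> I"
  shows "n i \<in> generated_semigroup n I"
proof -
  have "(\<Sum>j\<in>I. (if j = i then 1 else 0) * n j) = n i"
    using assms by (simp add: if_distrib[of "\<lambda>c. c * _"] cong: if_cong)
  then show ?thesis
    unfolding generated_semigroup_def by (auto intro!: exI[of _ "\<lambda>j. if j = i then 1 else 0"])
qed

lemma generated_semigroup_mult: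
  assumes "x \<in> generated_semigroup n I"
  shows "c * x \<in> generated_semigroup n I"
  by (induction c) (auto intro: generated_semigroup_zero generated_semigroup_add assms)

text \<open>An element of the semigroup from which no generator except \<open>n\<^sub>j\<close> can be split off has only
  \<open>n\<^sub>j\<close> in each of its representations.\<close>
lemma generated_semigroup_divisible_or_multiple:
  assumes "finite I" "j \<in> I" "x \<in> generated_semigroup n I"
    and "\<And>l s. l \<in> I \<Longrightarrow> s \<in> generated_semigroup n I \<Longrightarrow> x = n l + s \<Longrightarrow> l = j"
  shows "\<exists>c. x = c * n j"
proof -
  obtain a where a: "x = (\<Sum>i\<in>I. a i * n i)"
    using assms(3) unfolding generated_semigroup_def by auto
  have "a l = 0" if "l \<in> I - {j}" for l
  proof (rule ccontr)
    assume "a l \<noteq> 0"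
    let ?b = "\<lambda>i. if i = l then a l - 1 else a i"
    have "(\<Sum>i\<in>I. a i * n i) = a l * n l + (\<Sum>i\<in>I - {l}. a i * n i)"
      using that assms(1) by (simp add: sum.remove[of I l])
    moreover have "(\<Sum>i\<in>I. ?b i * n i) = (a l - 1) * n l + (\<Sum>i\<in>I - {l}. a i * n i)"
      using that assms(1) by (subst sum.remove[of _ l]) (auto intro!: sum.cong)
    ultimately have "x = n l + (\<Sum>i\<in>I. ?b i * n i)"
      using \<open>a l \<noteq> 0\<close> a by (cases "a l") auto
    moreover have "(\<Sum>i\<in>I. ?b i * n i) \<in> generated_semigroup n I"
      unfolding generated_semigroup_def by (rule CollectI, rule exI[of _ ?b]) simp
    ultimately show False
      using assms(4) that by blast
  qed
  then have "(\<Sum>i\<in>I - {j}. a i * n i) = 0"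
    by simp
  then have "x = a j * n j"
    using a assms(1,2) by (simp add: sum.remove[of I j])
  then show ?thesis ..
qed

text \<open>The least positive difference of two elements of the semigroup divides every generator: the
  remainder of a generator modulo this difference is again such a difference. As the generators have
  greatest common divisor one, the least difference is one.\<close>
lemma generated_semigroup_consecutive:
  assumes "finite I" "i \<in> I" "0 < n i" "Gcd (n ` I) = 1"
  obtains y where "y \<in> generated_semigroup n I" "y + 1 \<in> generated_semigroup n I"
proof -
  let ?S = "generated_semigroup n I"
  define D where "D = (\<lambda>d. 0 < d \<and> (\<exists>y\<in>?S. y + d \<in> ?S))"
  define d where "d = (LEAST d. D d)"
  have "D (n i)"
    unfolding D_def using assms generated_semigroup_generator[of I i n] generated_semigroup_zero[of n I]
    by (auto intro!: bexI[of _ 0])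
  then have "D d"
    unfolding d_def by (rule LeastI)
  then obtain y where y: "0 < d" "y \<in> ?S" "y + d \<in> ?S"
    unfolding D_def by auto
  have "d dvd n j" if "j \<in> I" for j
  proof (rule ccontr)
    assume "\<not> d dvd n j"
    then have "0 < n j mod d"
      by (simp add: mod_greater_zero_iff_not_dvd)
    moreover have "n j div d * (y + d) \<in> ?S"
      using y(3) by (rule generated_semigroup_mult)
    moreover have "n j div d * (y + d) + n j mod d \<in> ?S"
    proof -
      have "n j div d * (y + d) + n j mod d = n j div d * y + n j"
        by (simp add: distrib_left div_mult_mod_eq)
      then show ?thesis
        using y(2) that assms(1)
        by (simp only:) (intro generated_semigroup_add generated_semigroup_mult
          generated_semigroup_generator)
    qed
    ultimately have "D (n j mod d)"
      unfolding D_def by blast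
    then have "d \<le> n j mod d"
      unfolding d_def by (rule Least_le)
    then show False
      using mod_less_divisor[OF y(1), of "n j"] by simp
  qed
  then have "d dvd Gcd (n ` I)"
    by (intro Gcd_greatest) auto
  then show ?thesis
    using that[of y] y assms(4) by simp
qed

text \<open>If \<open>y\<close> and \<open>y + 1\<close> lie in the semigroup, then so does every \<open>m = qy + r\<close> with \<open>r \<le> q\<close>, as
  \<open>m = (q - r)y + r(y + 1)\<close>; this covers all \<open>m \<ge> y\<^sup>2\<close>.\<close>
lemma generated_semigroup_cofinite:
  assumes "finite I" "i \<in> I" "0 < n i" "Gcd (n ` I) = 1"
  shows "finite (- generated_semigroup n I)"
proof -
  let ?S = "generated_semigroup n I"
  obtain y where y: "y \<in> ?S" "y + 1 \<in> ?S"
    using generated_semigroup_consecutive[of I i n] assms by blast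
  have "m \<in> ?S" if m: "y * y \<le> m" for m
  proof (cases "y = 0")
    case True
    then show ?thesis
      using generated_semigroup_mult[OF y(2), of m] by simp
  next
    case False
    then have "m mod y < y"
      by simp
    also have "y \<le> m div y"
      using m False by (simp add: less_eq_div_iff_mult_less_eq)
    finally have le: "m mod y \<le> m div y"
      by simp
    have "(m div y - m mod y) * y + m mod y * (y + 1) = (m div y - m mod y + m mod y) * y + m mod y"
      by (simp only: distrib_right distrib_left mult_1_right add.assoc)
    also have "\<dots> = m"
      using le by (simp add: div_mult_mod_eq)
    finally have "m = (m div y - m mod y) * y + m mod y * (y + 1)" ..
    moreover have "(m div y - m mod y) * y + m mod y * (y + 1) \<in> ?S"
      by (rule generated_semigroup_add[OF generated_semigroup_mult generated_semigroup_mult, OF y])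
    ultimately show ?thesis
      by (simp only:)
  qed
  then have "- ?S \<subseteq> {..<y * y}"
    by (auto simp: not_le[symmetric])
  then show ?thesis
    by (rule finite_subset) simp
qed

text \<open>If 1 were in the semigroup, it would be one of the generators, and the others would be its
  multiples.\<close>
lemma one_not_in_generated_semigroup:
  assumes "finite I" "1 < card I" "minimal_generating_system n I"
  shows "1 \<notin> generated_semigroup n I"
proof
  assume "1 \<in> generated_semigroup n I"
  then obtain a where a: "(\<Sum>i\<in>I. a i * n i) = 1"
    unfolding generated_semigroup_def by auto
  then have "(\<Sum>i\<in>I. a i * n i) \<noteq> 0"
    by simp
  then obtain l where l: "l \<in> I" "a l * n l \<noteq> 0"
    by (rule sum.not_neutral_contains_not_neutral)
  have "a l * n l \<le> (\<Sum>i\<in>I. a i * n i)"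
    using assms(1) l by (intro member_le_sum) auto
  then have "a l * n l \<le> 1"
    by (simp only: a)
  then have "n l = 1"
    using l by (simp add: le_Suc_eq)
  have "I \<noteq> {l}"
    using assms(2) by auto
  then obtain j where j: "j \<in> I" "j \<noteq> l"
    using l by blast
  have "n l \<in> generated_semigroup n (I - {j})"
    using assms(1) l j by (intro generated_semigroup_generator) auto
  then have "n j * n l \<in> generated_semigroup n (I - {j})"
    by (rule generated_semigroup_mult)
  then have "n j \<in> generated_semigroup n (I - {j})"
    using \<open>n l = 1\<close> by simp
  then show False
    using assms(3) j unfolding minimal_generating_system_def by blast
qed

section \<open>Almost symmetric semigroups with four generators\<close>

text \<open>In the application \<open>P\<close> consists of all pseudo-Frobenius numbers except the largest gap \<open>F\<close>.\<close>
locale symmetric_pseudo_frobenius =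
  fixes n :: "'i \<Rightarrow> nat" and I :: "'i set" and P :: "nat set" and F :: nat
  assumes finite_I: "finite I"
    and pos: "i \<in> I \<Longrightarrow> 0 < n i"
    and finite_P: "finite P"
    and P_pf: "P \<subseteq> pseudo_frobenius (generated_semigroup n I)"
    and F_gap: "F \<notin> generated_semigroup n I"
    and P_le: "f \<in> P \<Longrightarrow> f \<le> F"
    and P_sym: "f \<in> P \<Longrightarrow> F - f \<in> P"
begin

abbreviation S :: "nat set" where
  "S \<equiv> generated_semigroup n I"

text \<open>The pairs \<open>(i, j)\<close> of distinct indices with \<open>f + n\<^sub>i - n\<^sub>j \<in> T\<close>. It is used for \<open>T = S\<close>, where these are the pairs
  for which \<open>n\<^sub>j\<close> occurs in some representation of \<open>f + n\<^sub>i\<close>, and for \<open>T = P\<close>.\<close>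
definition exchange :: "nat set \<Rightarrow> nat \<Rightarrow> ('i \<times> 'i) set" where
  "exchange T f = {(i, j). i \<in> I \<and> j \<in> I \<and> i \<noteq> j \<and> (\<exists>s\<in>T. f + n i = s + n j)}"

lemma P_not_S: "f \<in> P \<Longrightarrow> f \<notin> S"
  and P_add: "f \<in> P \<Longrightarrow> i \<in> I \<Longrightarrow> f + n i \<in> S"
  using P_pf pos generated_semigroup_generator[OF finite_I]
  unfolding pseudo_frobenius_def by (fastforce, fastforce)

lemma exchange_subset: "exchange T f \<subseteq> Sigma I (\<lambda>i. I - {i})"
  unfolding exchange_def by auto

lemma finite_exchange: "finite (exchange T f)"
  by (rule finite_subset[OF exchange_subset]) (use finite_I in auto)

text \<open>Two of the three memberships together would make \<open>F = f + (F - f)\<close> a sum of two elements of \<open>S\<close>,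
  or put an element of \<open>P\<close> into \<open>S\<close>.\<close>
lemma exchange_exclusive:
  assumes "f \<in> P"
  shows "exchange S f \<inter> (exchange S (F - f))\<inverse> = {}"
    and "exchange S f \<inter> exchange P f = {}"
    and "(exchange S (F - f))\<inverse> \<inter> exchange P f = {}"
proof -
  show "exchange S f \<inter> (exchange S (F - f))\<inverse> = {}"
  proof (rule ccontr)
    assume "exchange S f \<inter> (exchange S (F - f))\<inverse> \<noteq> {}"
    then obtain i j s s' where "s \<in> S" "s' \<in> S" "f + n i = s + n j" "F - f + n j = s' + n i"
      unfolding exchange_def by auto
    then have "F = s + s'"
      using P_le[OF assms] by linarith
    then show False
      using F_gap generated_semigroup_add \<open>s \<in> S\<close> \<open>s' \<in> S\<close> by blast
  qed
  show "exchange S f \<inter> exchange P f = {}"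
    unfolding exchange_def using P_not_S by auto
  show "(exchange S (F - f))\<inverse> \<inter> exchange P f = {}"
  proof (rule ccontr)
    assume "(exchange S (F - f))\<inverse> \<inter> exchange P f \<noteq> {}"
    then obtain i j s g where "s \<in> S" "g \<in> P" "f + n i = g + n j" "F - f + n j = s + n i"
      unfolding exchange_def by auto
    then have "F - g = s"
      using P_le[OF assms] by linarith
    then show False
      using P_not_S P_sym \<open>s \<in> S\<close> \<open>g \<in> P\<close> by blast
  qed
qed

lemma card_exchange_le:
  assumes "f \<in> P"
  shows "card (exchange S f) + card (exchange S (F - f)) + card (exchange P f)
    \<le> card I * (card I - 1)"
proof -
  have "card (exchange S f) + card (exchange S (F - f)) + card (exchange P f)
      = card (exchange S f \<union> (exchange S (F - f))\<inverse> \<union> exchange P f)"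
    using exchange_exclusive[OF assms] finite_exchange
    by (subst card_Un_disjoint; (auto simp: card_Un_disjoint)?)
  also have "\<dots> \<le> card (Sigma I (\<lambda>i. I - {i}))"
    using finite_I by (intro card_mono) (auto simp: exchange_def)
  also have "\<dots> = card I * (card I - 1)"
    using finite_I by simp
  finally show ?thesis .
qed

text \<open>For \<open>f \<in> P\<close> and such an index \<open>i\<close>, only one generator occurs in the representations of
  \<open>f + n\<^sub>i\<close>, which is therefore a multiple of this generator.\<close>
definition solitary :: "nat \<Rightarrow> 'i set" where
  "solitary f = {i \<in> I. \<exists>j. exchange S f `` {i} = {j}}"

text \<open>Since \<open>f + n\<^sub>i\<close> lies in \<open>S\<close>, some generator can be split off. If this were only \<open>n\<^sub>i\<close>, then \<open>f\<close>
  itself would be a multiple of \<open>n\<^sub>i\<close>.\<close>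
lemma exchange_row_nonempty:
  assumes "f \<in> P" "i \<in> I"
  shows "exchange S f `` {i} \<noteq> {}"
proof
  assume empty: "exchange S f `` {i} = {}"
  have divisible: "l = i" if "l \<in> I" "s \<in> S" "f + n i = n l + s" for l s
    using that empty assms unfolding exchange_def by (auto simp: add.commute)
  have "\<exists>c. f + n i = c * n i"
    by (rule generated_semigroup_divisible_or_multiple[OF finite_I assms(2) P_add[OF assms]])
      (rule divisible)
  then obtain c where c: "f + n i = c * n i" ..
  then have "f = (c - 1) * n i"
    by (simp add: diff_mult_distrib)
  then have "f \<in> S"
    using assms generated_semigroup_generator[OF finite_I] generated_semigroup_mult by metis
  then show False
    using P_not_S assms by blast
qed

text \<open>Each index has at least two partners, or one partner and counts as solitary.\<close>
lemma card_exchange_ge: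
  assumes "f \<in> P"
  shows "2 * card I \<le> card (exchange S f) + card (solitary f)"
proof -
  have "exchange S f = Sigma I (\<lambda>i. exchange S f `` {i})"
    unfolding exchange_def by auto
  then have "card (exchange S f) = (\<Sum>i\<in>I. card (exchange S f `` {i}))"
    using card_SigmaI[of I "\<lambda>i. exchange S f `` {i}"] finite_I finite_exchange by auto
  moreover have "card (solitary f) = (\<Sum>i\<in>I. if i \<in> solitary f then 1 else 0)"
    using finite_I by (simp add: solitary_def sum.If_cases Int_def)
  moreover have "2 \<le> card (exchange S f `` {i}) + (if i \<in> solitary f then 1 else 0)"
    if "i \<in> I" for i
  proof -
    have "card (exchange S f `` {i}) \<noteq> 0"
      using exchange_row_nonempty[OF assms that] finite_exchange by auto
    moreover have "i \<in> solitary f" if "card (exchange S f `` {i}) = 1"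
      using card_1_singletonE[OF that] \<open>i \<in> I\<close> unfolding solitary_def by auto
    ultimately show ?thesis
      by (auto, linarith)
  qed
  then have "(\<Sum>i\<in>I. 2) \<le> (\<Sum>i\<in>I. card (exchange S f `` {i}) + (if i \<in> solitary f then 1 else 0))"
    by (intro sum_mono)
  ultimately show ?thesis
    by (simp add: sum.distrib mult.commute)
qed

definition column :: "'i \<Rightarrow> 'i set" where
  "column j = {i \<in> I. \<exists>f\<in>P. exchange S f `` {i} = {j}}"

lemma solitary_multiple:
  assumes "f \<in> P" "i \<in> I" "exchange S f `` {i} = {j}"
  shows "\<exists>c. f + n i = c * n j"
proof (rule generated_semigroup_divisible_or_multiple[OF finite_I _ P_add[OF assms(1,2)]])
  show "j \<in> I"
    using assms unfolding exchange_def by auto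
  fix l s
  assume *: "l \<in> I" "s \<in> S" "f + n i = n l + s"
  then have "l \<noteq> i"
    using P_not_S assms by auto
  then show "l = j"
    using * assms unfolding exchange_def by (auto simp: add.commute)
qed

text \<open>If \<open>d > c\<close>, then
  \<open>g + n\<^sub>k = (d - c - 1)n\<^sub>j + (c + 1)n\<^sub>j = (d - c - 1)n\<^sub>j + (f + n\<^sub>j) + n\<^sub>i\<close>. Here \<open>f + n\<^sub>j\<close> lies in
  \<open>S\<close>, so \<open>n\<^sub>i\<close> can be split off from \<open>g + n\<^sub>k\<close>, although the only generator that can be
  split off is \<open>n\<^sub>j\<close>, and \<open>j \<noteq> i\<close>.\<close>
lemma solitary_multiple_unique:
  assumes f: "f \<in> P" "i \<in> I" "exchange S f `` {i} = {j}" "f + n i = c * n j"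
    and g: "g \<in> P" "k \<in> I" "exchange S g `` {k} = {j}" "g + n k = d * n j"
  shows "d \<le> c"
proof (rule ccontr)
  assume "\<not> d \<le> c"
  define e where "e = d - c - 1"
  have e: "d = c + 1 + e"
    using \<open>\<not> d \<le> c\<close> unfolding e_def by simp
  have ij: "j \<in> I" "i \<noteq> j"
    using f unfolding exchange_def by auto
  define s where "s = e * n j + (f + n j)"
  have "s \<in> S"
    unfolding s_def using ij f P_add generated_semigroup_add generated_semigroup_mult
      generated_semigroup_generator[OF finite_I] by metis
  have *: "g + n k = s + n i"
    using f(4) g(4) unfolding s_def e by (simp add: algebra_simps)
  show False
  proof (cases "i = k")
    case True
    then show False
      using * \<open>s \<in> S\<close> P_not_S g by auto
  next
    case False
    then have "(k, i) \<in> exchange S g"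
      unfolding exchange_def using * \<open>s \<in> S\<close> f g by auto
    then show False
      using g(3) ij by auto
  qed
qed

text \<open>Both sides are the multiple of \<open>n\<^sub>j\<close> that belongs to \<open>j\<close>. For \<open>i = k\<close> this gives \<open>f = g\<close>, and
  for \<open>i \<noteq> k\<close> it gives \<open>f + n\<^sub>i - n\<^sub>k = g \<in> P\<close>; the next two lemmas use one case each.\<close>
lemma solitary_same_column:
  assumes "f \<in> P" "i \<in> I" "exchange S f `` {i} = {j}"
    and "g \<in> P" "k \<in> I" "exchange S g `` {k} = {j}"
  shows "f + n i = g + n k"
proof -
  obtain c where c: "f + n i = c * n j"
    using solitary_multiple[OF assms(1-3)] ..
  obtain d where d: "g + n k = d * n j"
    using solitary_multiple[OF assms(4-6)] ..
  have "c = d"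
    using solitary_multiple_unique[OF assms(1-3) c assms(4-6) d]
      solitary_multiple_unique[OF assms(4-6) d assms(1-3) c] by (rule antisym[rotated])
  then show ?thesis
    using c d by simp
qed

lemma sum_solitary_le: "(\<Sum>f\<in>P. card (solitary f)) \<le> (\<Sum>j\<in>I. card (column j))"
proof -
  \<comment> \<open>A pair is sent to its partner and its index; the number \<open>f\<close> can be recovered from these.\<close>
  define h where "h = (\<lambda>(f, i). (THE j. exchange S f `` {i} = {j}, i))"
  have row: "exchange S f `` {i} = {fst (h (f, i))}" if "i \<in> solitary f" for f i
    using that unfolding h_def solitary_def by auto
  have "(\<Sum>f\<in>P. card (solitary f)) = card (Sigma P solitary)"
    using finite_P finite_I by (simp add: solitary_def)
  also have "\<dots> \<le> card (Sigma I column)"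
  proof (rule card_inj_on_le)
    show "inj_on h (Sigma P solitary)"
    proof (rule inj_onI, clarify)
      fix f i g k
      assume *: "f \<in> P" "i \<in> solitary f" "g \<in> P" "k \<in> solitary g" "h (f, i) = h (g, k)"
      then have "i = k"
        unfolding h_def by auto
      moreover have "fst (h (f, i)) = fst (h (g, k))" "i \<in> I" "k \<in> I"
        using * by (auto simp: solitary_def)
      then have "f + n i = g + n k"
        using * row solitary_same_column by metis
      ultimately show "f = g \<and> i = k"
        by simp
    qed
    show "h ` Sigma P solitary \<subseteq> Sigma I column"
    proof clarify
      fix f i j k
      assume *: "f \<in> P" "i \<in> solitary f" "(j, k) = h (f, i)"
      then have j: "exchange S f `` {i} = {j}"
        using row[of i f] by (metis fst_conv)
      then have "(i, j) \<in> exchange S f"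
        by auto
      then have "j \<in> I"
        unfolding exchange_def by simp
      moreover have "k = i"
        using * unfolding h_def by simp
      ultimately show "j \<in> I \<and> k \<in> column j"
        using * j unfolding column_def solitary_def by blast
    qed
    show "finite (Sigma I column)"
      using finite_I by (auto simp: column_def)
  qed
  also have "\<dots> = (\<Sum>j\<in>I. card (column j))"
    using finite_I by (simp add: column_def)
  finally show ?thesis .
qed

lemma sum_neutral_ge:
  "(\<Sum>j\<in>I. card (column j) * (card (column j) - 1)) \<le> (\<Sum>f\<in>P. card (exchange P f))"
proof -
  define X where "X = (\<lambda>j. Sigma (column j) (\<lambda>i. column j - {i}))"
  define w where "w = (\<lambda>i j. SOME f. f \<in> P \<and> exchange S f `` {i} = {j})"
  \<comment> \<open>The column \<open>j\<close> is the only partner of \<open>i\<close> for \<open>w i j\<close>, so \<open>h\<close> is injective.\<close>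
  define h where "h = (\<lambda>(j, i, k). (w i j, i :: 'i, k :: 'i))"
  have w: "w i j \<in> P" "exchange S (w i j) `` {i} = {j}" "i \<in> I" if "i \<in> column j" for i j
  proof -
    have "\<exists>f. f \<in> P \<and> exchange S f `` {i} = {j}"
      using that unfolding column_def by auto
    then show "w i j \<in> P" "exchange S (w i j) `` {i} = {j}"
      using someI_ex[of "\<lambda>f. f \<in> P \<and> exchange S f `` {i} = {j}"] unfolding w_def by auto
  qed (use that column_def in auto)
  have fin: "finite (column j)" for j
    using finite_I by (simp add: column_def)
  have "(\<Sum>j\<in>I. card (column j) * (card (column j) - 1)) = card (Sigma I X)"
    unfolding X_def using finite_I fin by simp
  also have "\<dots> \<le> card (Sigma P (exchange P))"
  proof (rule card_inj_on_le)
    show "inj_on h (Sigma I X)"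
      unfolding X_def h_def using w(2) by (intro inj_onI) (auto, (metis singleton_inject)+)
    show "h ` Sigma I X \<subseteq> Sigma P (exchange P)"
    proof clarify
      fix j i k f i' k'
      assume *: "j \<in> I" "(i, k) \<in> X j" "(f, i', k') = h (j, i, k)"
      then have "i \<in> column j" "k \<in> column j" "i \<noteq> k" "f = w i j" "i' = i" "k' = k"
        unfolding X_def h_def by auto
      moreover from this have "w i j + n i = w k j + n k"
        using solitary_same_column w by meson
      ultimately show "f \<in> P \<and> (i', k') \<in> exchange P f"
        unfolding exchange_def using w by auto
    qed
    show "finite (Sigma P (exchange P))"
      using finite_P finite_exchange by auto
  qed
  also have "\<dots> = (\<Sum>f\<in>P. card (exchange P f))"
    using finite_P finite_exchange by simp
  finally show ?thesis .
qed

lemma sum_reflect: "(\<Sum>f\<in>P. h (F - f)) = (\<Sum>f\<in>P. h f)"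
  using P_sym P_le
  by (intro sum.reindex_bij_witness[of P "\<lambda>f. F - f" "\<lambda>f. F - f"]) auto

theorem card_le_2:
  assumes "card I = 4"
  shows "card P \<le> 2"
proof -
  let ?d = "\<lambda>j. card (column j)"
  have "4 + card (exchange P f) \<le> card (solitary f) + card (solitary (F - f))" if "f \<in> P" for f
    using card_exchange_le[OF that] card_exchange_ge[OF that] card_exchange_ge[OF P_sym[OF that]]
      assms by simp
  then have "(\<Sum>f\<in>P. 4 + card (exchange P f))
      \<le> (\<Sum>f\<in>P. card (solitary f) + card (solitary (F - f)))"
    by (rule sum_mono)
  then have "4 * card P + (\<Sum>f\<in>P. card (exchange P f)) \<le> 2 * (\<Sum>f\<in>P. card (solitary f))"
    using sum_reflect[of "\<lambda>f. card (solitary f)"] by (simp add: sum.distrib)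
  then have "4 * card P + (\<Sum>j\<in>I. ?d j * (?d j - 1)) \<le> 2 * (\<Sum>j\<in>I. ?d j)"
    using sum_solitary_le sum_neutral_ge by linarith
  moreover have "2 * d \<le> d * (d - 1) + 2" for d :: nat
  proof -
    consider "d = 0" | "d = 1" | "d = 2" | "d \<ge> 3" by linarith
    then show ?thesis
    proof cases
      case 4
      then have "d * 2 \<le> d * (d - 1)" by (intro mult_le_mono2) linarith
      then show ?thesis by linarith
    qed auto
  qed
  then have "(\<Sum>j\<in>I. 2 * ?d j) \<le> (\<Sum>j\<in>I. ?d j * (?d j - 1) + 2)"
    by (intro sum_mono)
  then have "2 * (\<Sum>j\<in>I. ?d j) \<le> (\<Sum>j\<in>I. ?d j * (?d j - 1)) + 8"
    using assms by (simp only: sum.distrib sum_distrib_left[symmetric]) simp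
  ultimately show ?thesis
    by linarith
qed

end

section \<open>Laurent series with prescribed support\<close>

lemma type_ring_simps [simp]:
  "carrier type_ring = UNIV" "mult type_ring = (*)" "one type_ring = 1"
  "zero type_ring = 0" "add type_ring = (+)"
  by (simp_all add: type_ring_def)

lemma field_type_ring: "field (type_ring :: 'k::field ring)"
proof -
  have "cring (type_ring :: 'k ring)"
  proof (rule cringI)
    show "abelian_group (type_ring :: 'k ring)"
      by (rule abelian_groupI) (auto simp: algebra_simps intro: exI[of _ "- x" for x])
    show "comm_monoid (type_ring :: 'k ring)"
      by (rule comm_monoidI) (auto simp: algebra_simps)
  qed (auto simp: algebra_simps)
  then show ?thesis
    by (rule cring.cring_fieldI2) (simp_all, metis right_inverse)
qed

text \<open>The local ring of the curve, its maximal ideal, the normalization, and the ideals in the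
  duality argument are all of this form.\<close>
definition supported :: "int set \<Rightarrow> 'k::field fls set" where
  "supported T = {x. \<forall>z. x $$ z \<noteq> 0 \<longrightarrow> z \<in> T}"

lemma supportedI: "(\<And>z. x $$ z \<noteq> 0 \<Longrightarrow> z \<in> T) \<Longrightarrow> x \<in> supported T"
  unfolding supported_def by auto

lemma supportedD: "x \<in> supported T \<Longrightarrow> x $$ z \<noteq> 0 \<Longrightarrow> z \<in> T"
  unfolding supported_def by auto

lemma supported_natD: "x \<in> supported (int ` T) \<Longrightarrow> x $$ int d \<noteq> 0 \<Longrightarrow> d \<in> T"
  using supportedD[of x "int ` T" "int d"] by (simp add: inj_image_mem_iff)

lemma supported_mono: "T \<subseteq> U \<Longrightarrow> supported T \<subseteq> supported U"
  unfolding supported_def by auto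

lemma supported_zero [simp]: "0 \<in> supported T"
  unfolding supported_def by simp

lemma supported_add: "x \<in> supported T \<Longrightarrow> y \<in> supported T \<Longrightarrow> x + y \<in> supported T"
  by (rule supportedI) (metis add.right_neutral fls_plus_nth supportedD)

lemma supported_uminus: "x \<in> supported T \<Longrightarrow> - x \<in> supported T"
  by (rule supportedI) (metis fls_uminus_nth neg_equal_0_iff_equal supportedD)

lemma supported_mult:
  assumes "x \<in> supported T" "y \<in> supported U" "\<And>t u. t \<in> T \<Longrightarrow> u \<in> U \<Longrightarrow> t + u \<in> V"
  shows "x * y \<in> supported V"
proof (rule supportedI)
  fix z
  let ?a = "fls_subdegree x" and ?b = "fls_subdegree y"
  assume "(x * y) $$ z \<noteq> 0"
  then have "(\<Sum>i=?a + ?b..z. x $$ (i - ?b) * y $$ (?b + z - i)) \<noteq> 0"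
    by (simp add: fls_times_nth(1))
  then obtain i where "x $$ (i - ?b) \<noteq> 0" "y $$ (?b + z - i) \<noteq> 0"
    by (metis (no_types, lifting) mult_eq_0_iff sum.neutral)
  then have "(i - ?b) + (?b + z - i) \<in> V"
    using assms supportedD by blast
  then show "z \<in> V"
    by simp
qed

lemma supported_const: "0 \<in> T \<Longrightarrow> fls_const c \<in> supported T"
  by (rule supportedI) (auto split: if_splits)

lemma supported_one: "0 \<in> T \<Longrightarrow> 1 \<in> supported T"
  by (metis fls_const_1 supported_const)

definition t_power :: "int \<Rightarrow> 'k::field fls" where
  "t_power z = fls_X_intpow z"

lemma t_power_nth [simp]: "(t_power z :: 'k::field fls) $$ y = (if y = z then 1 else 0)"
  by (simp add: t_power_def)

lemma t_power_nonzero [simp]: "t_power z \<noteq> 0"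
  by (simp add: t_power_def)

lemma supported_t_power: "z \<in> T \<Longrightarrow> t_power z \<in> supported T"
  by (rule supportedI) (auto simp: t_power_nth split: if_splits)

lemma t_power_mult_nth: "(t_power z * x) $$ y = x $$ (y - z)"
  by (simp add: t_power_def fls_X_intpow_times_conv_shift)

lemma t_power_cancel: "t_power (- z) * (t_power z * x) = (x :: 'k::field fls)"
  by (rule fls_eqI) (simp add: t_power_mult_nth)

lemma supported_t_power_mult:
  assumes "x \<in> supported U" "\<And>u. u \<in> U \<Longrightarrow> z + u \<in> V"
  shows "t_power z * x \<in> supported V"
  using assms by (intro supported_mult[OF supported_t_power[of z "{z}"] assms(1)]) auto

lemma power_series_eq: "power_series = supported {0..}"
proof
  show "power_series \<subseteq> (supported {0..} :: 'a fls set)"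
    unfolding power_series_def by (auto intro!: supportedI split: if_splits)
  show "(supported {0..} :: 'a fls set) \<subseteq> power_series"
  proof
    fix x :: "'a fls"
    assume "x \<in> supported {0..}"
    then have "fps_to_fls (fls_regpart x) $$ z = x $$ z" for z
      using supportedD[of x _ z] by force
    then have "x = fps_to_fls (fls_regpart x)"
      by (intro fls_eqI) simp
    then show "x \<in> power_series"
      unfolding power_series_def by blast
  qed
qed

lemma finite_exponents:
  fixes n :: "'i \<Rightarrow> nat"
  assumes "finite I" "\<forall>i\<in>I. 0 < n i"
  shows "finite {a \<in> I \<rightarrow>\<^sub>E UNIV. (\<Sum>i\<in>I. a i * n i) = d}"
proof (rule finite_subset)
  show "{a \<in> I \<rightarrow>\<^sub>E UNIV. (\<Sum>i\<in>I. a i * n i) = d} \<subseteq> I \<rightarrow>\<^sub>E {..d}"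
  proof clarify
    fix a
    assume a: "a \<in> I \<rightarrow>\<^sub>E UNIV" "d = (\<Sum>i\<in>I. a i * n i)"
    have "a i \<le> (\<Sum>i\<in>I. a i * n i)" if "i \<in> I" for i
    proof -
      have "a i \<le> a i * n i"
        using assms that by (simp add: Suc_leI)
      also have "\<dots> \<le> (\<Sum>i\<in>I. a i * n i)"
        using assms that by (intro member_le_sum) auto
      finally show ?thesis .
    qed
    then show "a \<in> I \<rightarrow>\<^sub>E {..\<Sum>i\<in>I. a i * n i}"
      using a by (auto simp: PiE_iff)
  qed
  show "finite (I \<rightarrow>\<^sub>E {..d})"
    using assms by (intro finite_PiE) auto
qed

text \<open>To write a series with support in the semigroup as a value of the substitution, one chooses a
  single exponent vector \<open>e d\<close> for each degree \<open>d\<close> and puts the whole coefficient there.\<close>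
lemma monomial_power_series_eq:
  fixes n :: "'i \<Rightarrow> nat"
  assumes "finite I" "\<forall>i\<in>I. 0 < n i"
  shows "monomial_power_series n I = (supported (int ` generated_semigroup n I) :: 'k::field fls set)"
proof
  let ?X = "\<lambda>d. {a \<in> I \<rightarrow>\<^sub>E UNIV. (\<Sum>i\<in>I. a i * n i) = d}"
  have empty: "?X d = {}" if "d \<notin> generated_semigroup n I" for d
    using that unfolding generated_semigroup_def by auto
  show "monomial_power_series n I \<subseteq> (supported (int ` generated_semigroup n I) :: 'k fls set)"
  proof
    fix x :: "'k fls"
    assume "x \<in> monomial_power_series n I"
    then obtain c where x: "x = fps_to_fls (Abs_fps (\<lambda>d. \<Sum>a\<in>?X d. c a))"
      unfolding monomial_power_series_def by auto
    show "x \<in> supported (int ` generated_semigroup n I)"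
    proof (rule supportedI)
      fix z
      assume "x $$ z \<noteq> 0"
      then have z: "0 \<le> z" and nz: "(\<Sum>a\<in>?X (nat z). c a) \<noteq> 0"
        unfolding x by (simp_all split: if_splits)
      have "?X (nat z) \<noteq> {}"
        using nz by (rule contrapos_nn) (simp only: sum.empty)
      then have "nat z \<in> generated_semigroup n I"
        using empty[of "nat z"] by blast
      then show "z \<in> int ` generated_semigroup n I"
        using z by (intro image_eqI[of _ _ "nat z"]) simp_all
    qed
  qed
  show "(supported (int ` generated_semigroup n I) :: 'k fls set) \<subseteq> monomial_power_series n I"
  proof
    fix x :: "'k fls"
    assume x: "x \<in> supported (int ` generated_semigroup n I)"
    define e where "e = (\<lambda>d. SOME a. a \<in> ?X d)"
    have e: "e d \<in> ?X d" if d: "d \<in> generated_semigroup n I" for d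
    proof -
      obtain a where a: "d = (\<Sum>i\<in>I. a i * n i)"
        using d unfolding generated_semigroup_def by auto
      then have "restrict a I \<in> ?X d"
        by auto
      then show ?thesis
        unfolding e_def by (rule someI[of "\<lambda>a. a \<in> ?X d"])
    qed
    define c where "c = (\<lambda>a. let d = (\<Sum>i\<in>I. a i * n i) in if a = e d then x $$ int d else 0)"
    have "(\<Sum>a\<in>?X d. c a) = x $$ int d" for d
    proof (cases "d \<in> generated_semigroup n I")
      case True
      have "(\<Sum>a\<in>?X d. c a) = (\<Sum>a\<in>?X d. if a = e d then x $$ int d else 0)"
        by (intro sum.cong) (auto simp: c_def Let_def)
      also have "\<dots> = x $$ int d"
        using finite_exponents[OF assms] e[OF True] by simp
      finally show ?thesis .
    next
      case False
      then have "x $$ int d = 0"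
        using supported_natD[OF x] by blast
      then show ?thesis
        unfolding empty[OF False] by simp
    qed
    then have "Abs_fps (\<lambda>d. \<Sum>a\<in>?X d. c a) = fls_regpart x"
      by (intro fps_ext) simp
    moreover have "fps_to_fls (fls_regpart x) $$ z = x $$ z" for z
      using supportedD[OF x, of z] by force
    then have "x = fps_to_fls (fls_regpart x)"
      by (intro fls_eqI) simp
    ultimately show "x \<in> monomial_power_series n I"
      unfolding monomial_power_series_def by (auto intro!: exI[of _ c])
  qed
qed

section \<open>Almost Gorenstein semigroup rings\<close>

locale numerical_semigroup =
  fixes S :: "nat set" and F :: nat
  assumes zero_mem: "0 \<in> S"
    and add_mem: "x \<in> S \<Longrightarrow> y \<in> S \<Longrightarrow> x + y \<in> S"
    and frobenius_gap: "F \<notin> S"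
    and beyond_frobenius: "F < x \<Longrightarrow> x \<in> S"
begin

abbreviation A :: "'k::field fls set" where
  "A \<equiv> supported (int ` S)"

abbreviation M :: "'k::field fls set" where
  "M \<equiv> supported (int ` (S - {0}))"

abbreviation R :: "'k::field fls ring" where
  "R \<equiv> type_ring\<lparr>carrier := A\<rparr>"

lemma A_mult: "x \<in> A \<Longrightarrow> y \<in> A \<Longrightarrow> x * y \<in> A"
  by (erule (1) supported_mult) (use add_mem in \<open>force simp flip: of_nat_add\<close>)

lemma A_one: "1 \<in> A"
  using zero_mem by (intro supported_one) force

lemma A_const: "fls_const c \<in> A"
  using zero_mem by (intro supported_const) force

lemma tail_le: "{int F + 1..} \<subseteq> int ` S"
proof
  fix z
  assume "z \<in> {int F + 1..}"
  then show "z \<in> int ` S"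
    using beyond_frobenius[of "nat z"] by (intro image_eqI[of _ _ "nat z"]) auto
qed

lemma tail_subset: "supported {int F + 1..} \<subseteq> A"
  by (rule supported_mono) (rule tail_le)

lemma cring_R: "cring R"
proof (rule cringI)
  show "abelian_group R"
  proof (rule abelian_groupI)
    fix x assume "x \<in> carrier R"
    then show "\<exists>y\<in>carrier R. y \<oplus>\<^bsub>R\<^esub> x = \<zero>\<^bsub>R\<^esub>"
      by (intro bexI[of _ "- x"]) (auto intro: supported_uminus)
  qed (auto simp: add.commute add.left_commute intro: supported_add)
  show "comm_monoid R"
    by (rule comm_monoidI) (auto simp: mult.commute mult.left_commute intro: A_mult A_one)
qed (auto simp: algebra_simps)

lemma M_mult: "x \<in> A \<Longrightarrow> y \<in> M \<Longrightarrow> x * y \<in> M"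
  by (erule (1) supported_mult) (use add_mem in \<open>force simp flip: of_nat_add\<close>)

lemma M_subset: "M \<subseteq> A"
  by (rule supported_mono) auto

lemma M_iff: "x \<in> M \<longleftrightarrow> x \<in> A \<and> x $$ 0 = 0"
proof
  assume "x \<in> M"
  moreover have "0 \<notin> int ` (S - {0})"
    by auto
  ultimately show "x \<in> A \<and> x $$ 0 = 0"
    using M_subset supportedD[of x "int ` (S - {0})" 0] by blast
next
  assume *: "x \<in> A \<and> x $$ 0 = 0"
  show "x \<in> M"
  proof (rule supportedI)
    fix z
    assume z: "x $$ z \<noteq> 0"
    then have "z \<in> int ` S" "z \<noteq> 0"
      using * supportedD by auto
    then show "z \<in> int ` (S - {0})"
      by auto
  qed
qed

text \<open>Induction on the degree \<open>d\<close> of a coefficient of the inverse. For \<open>d \<notin> S\<close>, every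
  splitting \<open>d = i + (d - i)\<close> has \<open>i \<notin> S\<close> or \<open>d - i \<notin> S\<close>. So in the formula for the coefficient of
  \<open>x x\<^sup>-\<^sup>1 = 1\<close> in degree \<open>d\<close> only the summand with \<open>i = 0\<close> can be nonzero, and hence it is zero as well.\<close>
lemma inverse_in_A:
  fixes x :: "'k::field fls"
  assumes "x \<in> A" "x $$ 0 \<noteq> 0"
  shows "inverse x \<in> A"
proof -
  define y where "y = inverse x"
  have neg: "x $$ z = 0" if "z < 0" for z
    using supportedD[OF assms(1), of z] that by (cases "x $$ z = 0") auto
  have "x \<noteq> 0"
    using assms(2) by auto
  have sx: "fls_subdegree x = 0"
    using assms(2) neg by (intro fls_subdegree_eqI) auto
  have sy: "fls_subdegree y = 0"
    unfolding y_def using sx by simp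
  have "x * y = 1"
    unfolding y_def using \<open>x \<noteq> 0\<close> by simp
  have "int d \<in> int ` S" if "y $$ int d \<noteq> 0" for d
    using that
  proof (induction d rule: less_induct)
    case (less d)
    show ?case
    proof (rule ccontr)
      assume d: "int d \<notin> int ` S"
      then have "d \<noteq> 0"
        using zero_mem by auto
      have "0 = (x * y) $$ int d"
        using \<open>d \<noteq> 0\<close> by (simp add: \<open>x * y = 1\<close>)
      also have "\<dots> = (\<Sum>i=0..int d. x $$ i * y $$ (int d - i))"
        by (simp add: fls_times_nth(1) sx sy)
      also have "\<dots> = x $$ 0 * y $$ int d + (\<Sum>i\<in>{0..int d} - {0}. x $$ i * y $$ (int d - i))"
        by (subst sum.remove[of _ 0]) auto
      also have "(\<Sum>i\<in>{0..int d} - {0}. x $$ i * y $$ (int d - i)) = 0"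
      proof (rule sum.neutral, rule ballI, rule ccontr)
        fix i
        assume i: "i \<in> {0..int d} - {0}" and nz: "x $$ i * y $$ (int d - i) \<noteq> 0"
        then obtain s where s: "s \<in> S" "i = int s"
          using supportedD[OF assms(1), of i] by auto
        then have e: "int d - i = int (d - s)" "d - s < d"
          using i by auto
        then have "d - s \<in> S"
          using less.IH[of "d - s"] nz by auto
        then have "s + (d - s) \<in> S"
          using s add_mem by blast
        then show False
          using d s i by auto
      qed
      finally show False
        using less.prems assms(2) by simp
    qed
  qed
  moreover have "y $$ z = 0" if "z < 0" for z
    using sy that by simp
  ultimately have "y \<in> A"
    by (intro supportedI) (metis int_nat_eq linorder_not_less nat_0_le)
  then show ?thesis
    unfolding y_def .
qed

lemma a_inv_R: "x \<in> A \<Longrightarrow> \<ominus>\<^bsub>R\<^esub> x = - x"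
proof -
  interpret cring R by (rule cring_R)
  assume "x \<in> A"
  then show ?thesis
    by (intro minus_equality) (auto intro: supported_uminus)
qed

text \<open>Elements of \<open>A\<close> outside \<open>M\<close> have a nonzero constant coefficient and are units, so every proper
  ideal lies in \<open>M\<close>.\<close>
lemma maximal_M: "maximalideal (M :: 'k::field fls set) R"
  and maximal_unique: "maximalideal J (R :: 'k fls ring) \<Longrightarrow> J = M"
proof -
  interpret cring "R :: 'k fls ring" by (rule cring_R)
  have ideal_M: "ideal M (R :: 'k fls ring)"
  proof (rule idealI)
    show "ring (R :: 'k fls ring)"
      by (rule ring_axioms)
    show "subgroup M (add_monoid (R :: 'k fls ring))"
    proof (rule add.subgroupI)
      show "M \<subseteq> carrier (R :: 'k fls ring)"
        using M_subset by simp
      show "(M :: 'k fls set) \<noteq> {}"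
        using supported_zero by blast
      show "\<ominus>\<^bsub>R\<^esub> a \<in> M" if "a \<in> M" for a :: "'k fls"
        using that M_subset by (subst a_inv_R) (auto intro: supported_uminus)
    qed (auto intro: supported_add)
    show "x \<otimes>\<^bsub>R\<^esub> a \<in> M" "a \<otimes>\<^bsub>R\<^esub> x \<in> M" if "a \<in> M" "x \<in> carrier R" for a x :: "'k fls"
      using M_mult[of x a] that by (simp_all add: mult.commute)
  qed
  have proper: "J \<subseteq> M" if J: "ideal J R" "J \<noteq> carrier R" for J :: "'k fls set"
  proof
    fix x
    assume x: "x \<in> J"
    have "x \<in> A"
      using ideal.Icarr[OF J(1) x] by simp
    moreover have "x $$ 0 = 0"
    proof (rule ccontr)
      assume nz: "x $$ 0 \<noteq> 0"
      then have "x \<noteq> 0"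
        by auto
      have "inverse x \<otimes>\<^bsub>R\<^esub> x \<in> J"
        using inverse_in_A[OF \<open>x \<in> A\<close> nz] by (intro ideal.I_l_closed[OF J(1) x]) simp
      then have "\<one>\<^bsub>R\<^esub> \<in> J"
        using \<open>x \<noteq> 0\<close> by simp
      then show False
        using ideal.one_imp_carrier[OF J(1)] J(2) by blast
    qed
    ultimately show "x \<in> M"
      by (simp add: M_iff)
  qed
  have "1 \<notin> (M :: 'k fls set)"
    by (simp add: M_iff)
  then have M_ne: "carrier R \<noteq> (M :: 'k fls set)"
    using A_one by auto
  show "maximalideal (M :: 'k fls set) R"
    using ideal_M M_ne proper by (intro maximalidealI) auto
  show "J = M" if "maximalideal J (R :: 'k fls ring)"
  proof -
    interpret J: maximalideal J "R :: 'k fls ring" by fact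
    show ?thesis
      using J.I_maximal[OF ideal_M] proper[OF J.is_ideal] J.I_notcarr M_ne M_subset by auto
  qed
qed

lemma max_ideal_R: "max_ideal R = M"
  unfolding max_ideal_def using maximal_M maximal_unique by (rule the_equality)

abbreviation Q :: "'k::field fls ring" where
  "Q \<equiv> type_ring"

lemma module_Q: "module R (regular_module Q)"
proof (rule moduleI)
  show "cring R"
    by (rule cring_R)
  show "abelian_group (regular_module Q)"
    by (rule abelian_groupI)
      (auto simp: regular_module_def algebra_simps intro: exI[of _ "- x" for x])
qed (auto simp: regular_module_def algebra_simps)

lemma fractional_ideal_iff:
  "fractional_ideal Q A I \<longleftrightarrow> 0 \<in> I \<and> (\<forall>x\<in>I. \<forall>y\<in>I. x + y \<in> I) \<and> (\<forall>a\<in>A. \<forall>x\<in>I. a * x \<in> I)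
    \<and> I \<noteq> {0} \<and> (\<exists>d\<in>A - {0}. \<forall>x\<in>I. d * x \<in> A)"
  unfolding fractional_ideal_def submodule_def
  using module_Q by (auto simp: regular_module_def)

text \<open>The module \<open>A + t\<^sup>y k[[t]]\<close>. For growing \<open>y\<close> these modules descend from \<open>k[[t]]\<close> to \<open>A\<close>, and they
  change from \<open>y\<close> to \<open>y + 1\<close> exactly when \<open>y\<close> is a gap.\<close>
definition step_ideal :: "nat \<Rightarrow> 'k::field fls set" where
  "step_ideal y = supported (int ` S \<union> {int y..})"

lemma fractional_step_ideal: "fractional_ideal Q A (step_ideal y)"
  unfolding fractional_ideal_iff
proof (intro conjI ballI)
  show "0 \<in> step_ideal y"
    by (simp add: step_ideal_def)
  show "x + z \<in> step_ideal y" if "x \<in> step_ideal y" "z \<in> step_ideal y" for x z :: "'a fls"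
    using that unfolding step_ideal_def by (rule supported_add)
  show "a * x \<in> step_ideal y" if "a \<in> A" "x \<in> step_ideal y" for a x :: "'a fls"
    using that unfolding step_ideal_def
    by (rule supported_mult) (use add_mem in \<open>force simp flip: of_nat_add\<close>)
  have "1 \<in> (step_ideal y :: 'a fls set)"
    unfolding step_ideal_def using zero_mem by (intro supported_one) force
  then show "step_ideal y \<noteq> ({0} :: 'a fls set)"
    by auto
  have "t_power (int F + 1) * x \<in> A" if "x \<in> step_ideal y" for x :: "'a fls"
  proof -
    have "x \<in> supported {0..}"
      using that unfolding step_ideal_def by (rule subsetD[OF supported_mono, rotated]) auto
    then have "t_power (int F + 1) * x \<in> supported {int F + 1..}"
      by (rule supported_t_power_mult) auto
    then show ?thesis
      using tail_subset by blast
  qed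
  moreover have "(t_power (int F + 1) :: 'a fls) \<in> A - {0}"
    using tail_subset supported_t_power[of "int F + 1" "{int F + 1..}"] by auto
  ultimately show "\<exists>d\<in>A - {0 :: 'a fls}. \<forall>x\<in>step_ideal y. d * x \<in> A"
    by blast
qed

lemma A_eq_step_ideal: "A = step_ideal (F + 1)"
proof -
  have "int ` S \<union> {int (F + 1)..} = int ` S"
    using tail_le by auto
  then show ?thesis
    unfolding step_ideal_def by simp
qed

lemma split_at:
  assumes "x \<in> supported (T \<union> {y..})"
  obtains u v where "x = u + v" "u \<in> supported T" "v \<in> supported {y..}"
proof -
  define v where "v = fls_shift (- y) (fps_to_fls (fls_regpart (fls_shift y x)))"
  have v: "v $$ z = (if z < y then 0 else x $$ z)" for z
    unfolding v_def by simp
  show ?thesis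
  proof
    show "x = (x - v) + v"
      by simp
    show "x - v \<in> supported T"
    proof (rule supportedI)
      fix z
      assume "(x - v) $$ z \<noteq> 0"
      then have "z < y" "x $$ z \<noteq> 0"
        using v by (auto split: if_splits)
      then show "z \<in> T"
        using supportedD[OF assms, of z] by auto
    qed
    show "v \<in> supported {y..}"
      by (rule supportedI) (auto simp: v split: if_splits)
  qed
qed

context
  fixes \<omega> :: "'k::field fls set"
  assumes canonical: "canonical_ideal Q A \<omega>"
    and A_le: "A \<subseteq> \<omega>"
    and le_power_series: "\<omega> \<subseteq> power_series"
begin

lemma omega_add: "x \<in> \<omega> \<Longrightarrow> y \<in> \<omega> \<Longrightarrow> x + y \<in> \<omega>"
  and omega_mult: "a \<in> A \<Longrightarrow> x \<in> \<omega> \<Longrightarrow> a * x \<in> \<omega>"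
  using canonical unfolding canonical_ideal_def fractional_ideal_iff by auto

lemma omega_nonneg: "\<omega> \<subseteq> supported {0..}"
  using le_power_series unfolding power_series_eq .

lemma tail_subset_omega: "supported {int F + 1..} \<subseteq> \<omega>"
  using tail_subset A_le by blast

lemma double_dual: "fractional_ideal Q A I \<Longrightarrow> colon Q \<omega> (colon Q \<omega> I) = I"
  using canonical unfolding canonical_ideal_def by blast

lemma colon_omega_omega: "colon Q \<omega> \<omega> = A"
proof -
  have "colon Q \<omega> A = \<omega>"
  proof
    show "colon Q \<omega> A \<subseteq> \<omega>"
      unfolding colon_def using A_one by force
    show "\<omega> \<subseteq> colon Q \<omega> A"
      unfolding colon_def using omega_mult by (simp add: subset_eq) (metis mult.commute)
  qed
  moreover have "fractional_ideal Q A (A :: 'k fls set)"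
    using fractional_step_ideal[of "F + 1"] unfolding A_eq_step_ideal[symmetric] .
  ultimately show ?thesis
    using double_dual[of A] by simp
qed

text \<open>If \<open>\<omega>\<close> contained an element of order \<open>F\<close>, it would contain \<open>t\<^sup>F\<close>, as it contains all
  series of larger order, and then, because of \<open>\<omega> \<subseteq> k[[t]]\<close>, all of \<open>t\<^sup>F \<omega>\<close>. Then \<open>t\<^sup>F\<close> would lie in \<open>\<omega> : \<omega> = A\<close>.\<close>
lemma subdegree_ne_frobenius:
  assumes "w \<in> \<omega>" "w \<in> supported {int F..}"
  shows "w $$ int F = 0"
proof (rule ccontr)
  assume nz: "w $$ int F \<noteq> 0"
  have "t_power (int F) - fls_const (inverse (w $$ int F)) * w \<in> supported {int F + 1..}"
  proof (rule supportedI)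
    fix z
    assume z: "(t_power (int F) - fls_const (inverse (w $$ int F)) * w) $$ z \<noteq> 0"
    then have "z \<noteq> int F"
      using nz by auto
    then have "w $$ z \<noteq> 0"
      using z by (auto simp: t_power_nth)
    then show "z \<in> {int F + 1..}"
      using supportedD[OF assms(2), of z] \<open>z \<noteq> int F\<close> by auto
  qed
  then have "t_power (int F) - fls_const (inverse (w $$ int F)) * w
      + fls_const (inverse (w $$ int F)) * w \<in> \<omega>"
    using tail_subset_omega omega_mult[OF A_const assms(1)] omega_add by blast
  then have t: "t_power (int F) \<in> \<omega>"
    by simp
  have "t_power (int F) * v \<in> \<omega>" if "v \<in> \<omega>" for v
  proof -
    have "t_power (int F) * v - fls_const (v $$ 0) * t_power (int F) \<in> supported {int F + 1..}"
    proof (rule supportedI)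
      fix z
      assume z: "(t_power (int F) * v - fls_const (v $$ 0) * t_power (int F)) $$ z \<noteq> 0"
      then have ne: "z \<noteq> int F"
        by (auto simp: t_power_mult_nth)
      then have "v $$ (z - int F) \<noteq> 0"
        using z by (auto simp: t_power_mult_nth)
      then show "z \<in> {int F + 1..}"
        using supportedD[of v "{0..}"] that omega_nonneg ne by fastforce
    qed
    then have "t_power (int F) * v - fls_const (v $$ 0) * t_power (int F)
        + fls_const (v $$ 0) * t_power (int F) \<in> \<omega>"
      using tail_subset_omega omega_mult[OF A_const t] omega_add by blast
    then show ?thesis
      by simp
  qed
  then have "t_power (int F) \<in> colon Q \<omega> \<omega>"
    unfolding colon_def by simp
  then have "t_power (int F) \<in> (A :: 'k fls set)"
    unfolding colon_omega_omega .
  then have "int F \<in> int ` S"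
    by (rule supportedD) (simp add: t_power_nth)
  then show False
    using frobenius_gap by auto
qed

text \<open>If \<open>y\<close> had order at most \<open>F\<close>, a monomial multiple of \<open>y\<close> in \<open>\<omega>\<close> would have order exactly \<open>F\<close>.\<close>
lemma conductor_omega:
  assumes "\<And>b. b \<in> supported {0..} \<Longrightarrow> y * b \<in> \<omega>"
  shows "y \<in> supported {int F + 1..}"
proof (rule supportedI)
  fix z
  assume "y $$ z \<noteq> 0"
  then have "y \<noteq> 0" and le: "fls_subdegree y \<le> z"
    by (auto intro: fls_subdegree_leI)
  have "\<not> fls_subdegree y \<le> int F"
  proof
    assume *: "fls_subdegree y \<le> int F"
    define w where "w = t_power (int F - fls_subdegree y) * y"
    have "w \<in> \<omega>"
      unfolding w_def using assms[OF supported_t_power[of "int F - fls_subdegree y"]] *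
      by (simp add: mult.commute)
    moreover have "w \<in> supported {int F..}"
    proof (rule supportedI)
      fix u
      assume "w $$ u \<noteq> 0"
      then have "fls_subdegree y \<le> u - (int F - fls_subdegree y)"
        by (intro fls_subdegree_leI) (simp add: w_def t_power_mult_nth)
      then show "u \<in> {int F..}"
        by simp
    qed
    ultimately have "w $$ int F = 0"
      by (rule subdegree_ne_frobenius)
    then show False
      using \<open>y \<noteq> 0\<close> by (simp add: w_def t_power_mult_nth)
  qed
  then show "z \<in> {int F + 1..}"
    using le by simp
qed

text \<open>Multiplying \<open>A\<close> into \<open>\<omega>\<close> means lying in \<open>\<omega>\<close>, and multiplying \<open>t\<^sup>y k[[t]]\<close> into \<open>\<omega>\<close> means having
  order at least \<open>F + 1 - y\<close>, by the previous lemma.\<close>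
lemma colon_step_ideal:
  "colon Q \<omega> (step_ideal y) = \<omega> \<inter> supported {int F + 1 - int y..}"
proof
  show "colon Q \<omega> (step_ideal y) \<subseteq> \<omega> \<inter> supported {int F + 1 - int y..}"
  proof
    fix w
    assume "w \<in> colon Q \<omega> (step_ideal y)"
    then have w: "w * x \<in> \<omega>" if "x \<in> step_ideal y" for x
      using that unfolding colon_def by auto
    have "1 \<in> (step_ideal y :: 'k fls set)"
      unfolding step_ideal_def using zero_mem by (intro supported_one) force
    then have "w \<in> \<omega>"
      using w by force
    have "t_power (int y) * w \<in> supported {int F + 1..}"
    proof (rule conductor_omega)
      fix b :: "'k fls"
      assume "b \<in> supported {0..}"
      then have "t_power (int y) * b \<in> supported (int ` S \<union> {int y..})"
        by (rule supported_t_power_mult) auto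
      then show "t_power (int y) * w * b \<in> \<omega>"
        using w unfolding step_ideal_def by (metis mult.assoc mult.commute)
    qed
    have "w \<in> supported {int F + 1 - int y..}"
    proof (rule supportedI)
      fix z
      assume "w $$ z \<noteq> 0"
      then have "z + int y \<in> {int F + 1..}"
        by (intro supportedD[OF \<open>t_power (int y) * w \<in> _\<close>]) (simp add: t_power_mult_nth)
      then show "z \<in> {int F + 1 - int y..}"
        by simp
    qed
    then show "w \<in> \<omega> \<inter> supported {int F + 1 - int y..}"
      using \<open>w \<in> \<omega>\<close> by blast
  qed
  show "\<omega> \<inter> supported {int F + 1 - int y..} \<subseteq> colon Q \<omega> (step_ideal y)"
  proof
    fix w
    assume w: "w \<in> \<omega> \<inter> supported {int F + 1 - int y..}"
    have "w * x \<in> \<omega>" if x: "x \<in> step_ideal y" for x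
    proof -
      obtain u v where uv: "x = u + v" "u \<in> A" "v \<in> supported {int y..}"
        using split_at[of x "int ` S" "int y"] x unfolding step_ideal_def by metis
      have "w * v \<in> supported {int F + 1..}"
        using w uv by (intro supported_mult[of w "{int F + 1 - int y..}" v "{int y..}"]) auto
      then have "u * w + w * v \<in> \<omega>"
        using w uv omega_mult omega_add tail_subset_omega by blast
      then show ?thesis
        by (simp add: uv algebra_simps)
    qed
    then show "w \<in> colon Q \<omega> (step_ideal y)"
      unfolding colon_def by simp
  qed
qed

text \<open>Taking the dual is injective on fractional ideals, so the duals of the step ideals at \<open>x\<close> and
  \<open>x + 1\<close> differ. They can only differ in an element of order \<open>F - x\<close>.\<close>
lemma omega_has_dual_value:
  assumes "x \<notin> S" "x \<le> F"
  obtains w where "w \<in> \<omega>" "w $$ int (F - x) \<noteq> 0" "w \<in> supported {int (F - x)..}"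
proof -
  have "(t_power (int x) :: 'k fls) \<in> step_ideal x"
    unfolding step_ideal_def by (rule supported_t_power) auto
  moreover have "(t_power (int x) :: 'k fls) \<notin> step_ideal (x + 1)"
    unfolding step_ideal_def using assms(1)
      supportedD[of "t_power (int x) :: 'k fls" "int ` S \<union> {int (x + 1)..}" "int x"] by auto
  ultimately have "(step_ideal x :: 'k fls set) \<noteq> step_ideal (x + 1)"
    by blast
  then have "colon Q \<omega> (step_ideal x) \<noteq> colon Q \<omega> (step_ideal (x + 1))"
    using double_dual[OF fractional_step_ideal] by metis
  then have "\<omega> \<inter> supported {int F + 1 - int x..} \<noteq> \<omega> \<inter> supported {int F - int x..}"
    unfolding colon_step_ideal by simp
  moreover have "supported {int F + 1 - int x..} \<subseteq> (supported {int F - int x..} :: 'k fls set)"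
    by (rule supported_mono) auto
  ultimately obtain w where w: "w \<in> \<omega>" "w \<in> supported {int F - int x..}"
      "w \<notin> supported {int F + 1 - int x..}"
    by blast
  then obtain z where z: "w $$ z \<noteq> 0" "z \<notin> {int F + 1 - int x..}"
    unfolding supported_def by auto
  then have "z = int F - int x"
    using supportedD[OF w(2)] by force
  then show ?thesis
    using that[of w] w z assms(2) by (simp add: of_nat_diff)
qed

end

theorem almost_Gorenstein_imp_symmetric:
  assumes "almost_Gorenstein (type_ring :: 'k::field fls ring) A power_series"
    and f: "f \<in> pseudo_frobenius S" "f \<noteq> F"
  shows "f < F" "F - f \<in> pseudo_frobenius S - {F}"
proof -
  have fS: "f \<notin> S" "\<And>s. s \<in> S \<Longrightarrow> s \<noteq> 0 \<Longrightarrow> f + s \<in> S"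
    using f unfolding pseudo_frobenius_def by auto
  then show "f < F"
    using f beyond_frobenius by (meson linorder_neqE_nat)
  obtain \<omega> :: "'k fls set" where \<omega>: "canonical_ideal Q A \<omega>" "A \<subseteq> \<omega>" "\<omega> \<subseteq> power_series"
    and absorb: "\<And>a w. a \<in> M \<Longrightarrow> w \<in> \<omega> \<Longrightarrow> a * w \<in> M"
    using assms(1) unfolding almost_Gorenstein_def max_ideal_R by auto
  obtain w where w: "w \<in> \<omega>" "w $$ int (F - f) \<noteq> 0" "w \<in> supported {int (F - f)..}"
    using omega_has_dual_value[OF \<omega> fS(1)] \<open>f < F\<close> by auto
  have "F - f \<notin> S"
    using fS(2)[of "F - f"] \<open>f < F\<close> frobenius_gap by auto
  moreover have "F - f + s \<in> S" if "s \<in> S" "s \<noteq> 0" for s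
  proof -
    have "t_power (int s) * w \<in> M"
      using that w by (intro absorb supported_t_power) auto
    then have "F - f + s \<in> S - {0}"
      by (rule supported_natD) (use w in \<open>simp add: t_power_mult_nth\<close>)
    then show ?thesis
      by simp
  qed
  moreover have "f \<noteq> 0"
    using fS(1) zero_mem by metis
  ultimately show "F - f \<in> pseudo_frobenius S - {F}"
    using \<open>f < F\<close> unfolding pseudo_frobenius_def by auto
qed

end

section \<open>Modules in the construction of Ext\<close>

context vectorspace
begin

text \<open>The step in which a generating set grows by one vector.\<close>
lemma span_contains_combination:
  assumes "X \<subseteq> carrier V" "v \<in> span X" "x \<in> X" "c \<in> carrier K"
  shows "v \<oplus>\<^bsub>V\<^esub> c \<odot>\<^bsub>V\<^esub> x \<in> span X"
proof -
  have "submodule K (span X) V"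
    using assms(1) by (rule span_is_submodule)
  moreover have "x \<in> span X"
    using in_own_span[OF assms(1)] assms(3) by blast
  ultimately show ?thesis
    using assms by (simp add: submodule_def)
qed

lemma vdim_le_card:
  assumes "finite X" "X \<subseteq> carrier V" "carrier V \<subseteq> span X"
  shows "vdim K V \<le> enat (card X)"
proof -
  have gen: "gen_set X"
    using assms span_is_subset2 by blast
  then have "fin_dim"
    unfolding fin_dim_def using assms by blast
  moreover have "dim \<le> card X"
    using gen_ge_dim assms gen by blast
  ultimately show ?thesis
    unfolding vdim_def by simp
qed

end

lemma module_regular:
  assumes "cring R"
  shows "module R (regular_module R)"
proof -
  interpret cring R by fact
  show ?thesis
  proof (rule moduleI)
    show "abelian_group (regular_module R)"
      by (rule abelian_groupI) (auto simp: regular_module_def a_ac intro: add.l_inv_ex)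
  qed (auto simp: regular_module_def assms l_distr r_distr m_assoc)
qed

text \<open>Quotients are treated through representatives: every element is a coset \<open>H +> x\<close>, and the
  operations are those of the representatives.\<close>
locale quotient_by_submodule = module R M for R and M (structure) +
  fixes H
  assumes submodule: "submodule R H M"
begin

lemma subset: "H \<subseteq> carrier M"
  and closed: "v \<in> H \<Longrightarrow> w \<in> H \<Longrightarrow> v \<oplus> w \<in> H" "\<zero> \<in> H" "c \<in> carrier R \<Longrightarrow> v \<in> H \<Longrightarrow> c \<odot> v \<in> H"
  using submodule unfolding submodule_def by auto

sublocale abelian_subgroup H M
proof (rule abelian_subgroupI3)
  show "abelian_group M" ..
  have "\<ominus> x \<in> H" if "x \<in> H" for x
    using closed(3)[of "\<ominus>\<^bsub>R\<^esub> \<one>\<^bsub>R\<^esub>" x] that subset by (auto simp: smult_l_minus)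
  then show "additive_subgroup H M"
    using subset closed
    by (intro additive_subgroupI add.subgroupI) (auto simp flip: a_inv_def)
qed

lemma carrier_quotient: "carrier (quotient_module M H) = (\<lambda>x. H +> x) ` carrier M"
  by (auto simp: quotient_module_def A_RCOSETS_def')

lemma add_quotient:
  "x \<in> carrier M \<Longrightarrow> y \<in> carrier M
    \<Longrightarrow> (H +> x) \<oplus>\<^bsub>quotient_module M H\<^esub> (H +> y) = H +> (x \<oplus> y)"
  by (simp add: quotient_module_def a_rcos_sum)

lemma coset_eq_iff: "x \<in> carrier M \<Longrightarrow> H +> x = H \<longleftrightarrow> x \<in> H"
  using a_coset_join2[of x H] a_rcos_self[of x] a_subgroup by auto

lemma zero_quotient: "\<zero>\<^bsub>quotient_module M H\<^esub> = H"
  by (simp add: quotient_module_def)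

lemma smult_quotient:
  assumes "r \<in> carrier R" "x \<in> carrier M"
  shows "r \<odot>\<^bsub>quotient_module M H\<^esub> (H +> x) = H +> (r \<odot> x)"
proof -
  have "H +> (r \<odot> y) = H +> (r \<odot> x)" if y: "y \<in> H +> x" for y
  proof -
    obtain h where h: "h \<in> H" "y = h \<oplus> x"
      using y by (auto simp: a_r_coset_def')
    then have "r \<odot> y = (r \<odot> h) \<oplus> (r \<odot> x)"
      using assms subset by (auto simp: smult_r_distr)
    then have "r \<odot> y \<in> H +> (r \<odot> x)"
      using h closed assms by (auto simp: a_r_coset_def')
    then show ?thesis
      using assms a_subgroup by (intro a_repr_independence[symmetric]) auto
  qed
  moreover have "x \<in> H +> x"
    by (rule a_rcos_self) (rule assms)
  ultimately have "(\<Union>y\<in>H +> x. H +> (r \<odot> y)) = H +> (r \<odot> x)"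
    by blast
  then show ?thesis
    by (simp add: quotient_module_def)
qed

lemma module_quotient: "module R (quotient_module M H)"
proof (rule moduleI)
  show "cring R" ..
  show "abelian_group (quotient_module M H)"
  proof (rule abelian_groupI)
    show "\<zero>\<^bsub>quotient_module M H\<^esub> \<in> carrier (quotient_module M H)"
      by (simp add: quotient_module_def a_subgroup_in_rcosets)
    fix X assume X: "X \<in> carrier (quotient_module M H)"
    then obtain x where x: "x \<in> carrier M" "X = H +> x"
      unfolding carrier_quotient by auto
    then have "(H +> (\<ominus> x)) \<oplus>\<^bsub>quotient_module M H\<^esub> X = H"
      using add_quotient[of "\<ominus> x" x] coset_eq_iff[of \<zero>] closed by (simp add: l_neg)
    then show "\<exists>Y\<in>carrier (quotient_module M H). Y \<oplus>\<^bsub>quotient_module M H\<^esub> X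
        = \<zero>\<^bsub>quotient_module M H\<^esub>"
      using x unfolding carrier_quotient by (auto simp: quotient_module_def)
    show "\<zero>\<^bsub>quotient_module M H\<^esub> \<oplus>\<^bsub>quotient_module M H\<^esub> X = X"
      using x add_quotient[of \<zero> x] coset_eq_iff[of \<zero>] closed by (simp add: zero_quotient)
  qed (auto simp: carrier_quotient add_quotient a_ac)
qed (auto simp: carrier_quotient add_quotient smult_quotient smult_l_distr smult_r_distr
      smult_assoc1)

end

lemma module_restrict_scalars:
  assumes "cring K" "module R M"
    and h: "h \<in> carrier K \<rightarrow> carrier R" "h \<one>\<^bsub>K\<^esub> = \<one>\<^bsub>R\<^esub>"
      "\<And>a b. a \<in> carrier K \<Longrightarrow> b \<in> carrier K \<Longrightarrow> h (a \<oplus>\<^bsub>K\<^esub> b) = h a \<oplus>\<^bsub>R\<^esub> h b"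
      "\<And>a b. a \<in> carrier K \<Longrightarrow> b \<in> carrier K \<Longrightarrow> h (a \<otimes>\<^bsub>K\<^esub> b) = h a \<otimes>\<^bsub>R\<^esub> h b"
  shows "module K (restrict_scalars h M)"
proof -
  interpret module R M by fact
  show ?thesis
  proof (rule moduleI)
    show "cring K" by fact
    show "abelian_group (restrict_scalars h M)"
      by (rule abelian_groupI) (auto simp: restrict_scalars_def M.a_ac intro: M.add.l_inv_ex)
  qed (use h in \<open>auto simp: restrict_scalars_def Pi_iff smult_l_distr smult_r_distr smult_assoc1\<close>)
qed

lemma module_hom_module:
  assumes "module R M" "module R N"
  shows "module R (hom_module R M N)"
proof -
  interpret M: module R M by fact
  interpret N: module R N by fact
  have zero: "(\<lambda>x\<in>carrier M. \<zero>\<^bsub>N\<^esub>) \<in> module_hom R M N"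
    unfolding module_hom_def by auto
  have add: "(\<lambda>x\<in>carrier M. f x \<oplus>\<^bsub>N\<^esub> g x) \<in> module_hom R M N"
    if "f \<in> module_hom R M N" "g \<in> module_hom R M N" for f g
    using that unfolding module_hom_def
    by (auto simp: N.a_ac Pi_iff N.smult_r_distr)
  have smult: "(\<lambda>x\<in>carrier M. r \<odot>\<^bsub>N\<^esub> f x) \<in> module_hom R M N"
    if "r \<in> carrier R" "f \<in> module_hom R M N" for r f
    using that unfolding module_hom_def
    by (auto simp: Pi_iff N.smult_r_distr N.smult_assoc1[symmetric] M.R.m_comm)
  note closed = module_hom_closed[THEN Pi_mem]
  show ?thesis
  proof (rule moduleI)
    show "cring R" ..
    show "abelian_group (hom_module R M N)"
    proof (rule abelian_groupI)
      fix f assume f: "f \<in> carrier (hom_module R M N)"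
      then have "(\<lambda>x\<in>carrier M. (\<ominus>\<^bsub>R\<^esub> \<one>\<^bsub>R\<^esub>) \<odot>\<^bsub>N\<^esub> f x) \<in> carrier (hom_module R M N)"
        using smult by (simp add: hom_module_def)
      moreover have "(\<lambda>x\<in>carrier M. (\<ominus>\<^bsub>R\<^esub> \<one>\<^bsub>R\<^esub>) \<odot>\<^bsub>N\<^esub> f x) \<oplus>\<^bsub>hom_module R M N\<^esub> f
          = \<zero>\<^bsub>hom_module R M N\<^esub>"
        using f closed[of f R M N]
        by (auto simp: hom_module_def N.smult_l_minus N.M.l_neg)
      ultimately show "\<exists>g\<in>carrier (hom_module R M N). g \<oplus>\<^bsub>hom_module R M N\<^esub> f
          = \<zero>\<^bsub>hom_module R M N\<^esub>"
        by blast
      show "\<zero>\<^bsub>hom_module R M N\<^esub> \<oplus>\<^bsub>hom_module R M N\<^esub> f = f"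
        using f closed[of f R M N]
        by (auto simp: hom_module_def extensional_def)
    qed (auto simp: hom_module_def zero add N.a_ac closed)
  qed (auto simp: hom_module_def smult closed extensional_def N.smult_l_distr N.smult_r_distr
      N.smult_assoc1)
qed

lemma module_free:
  assumes "cring R"
  shows "module R (free_module R X)"
proof -
  interpret cring R by fact
  have add: "(\<lambda>x\<in>X. f x \<oplus>\<^bsub>R\<^esub> g x) \<in> carrier (free_module R X)"
    if "f \<in> carrier (free_module R X)" "g \<in> carrier (free_module R X)" for f g
  proof -
    have "finite ({x \<in> X. f x \<noteq> \<zero>\<^bsub>R\<^esub>} \<union> {x \<in> X. g x \<noteq> \<zero>\<^bsub>R\<^esub>})"
      using that by (simp add: free_module_def)
    then have "finite {x \<in> X. f x \<oplus>\<^bsub>R\<^esub> g x \<noteq> \<zero>\<^bsub>R\<^esub>}"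
      by (rule rev_finite_subset) (use that in \<open>auto simp: free_module_def\<close>)
    moreover have "{x \<in> X. (\<lambda>x\<in>X. f x \<oplus>\<^bsub>R\<^esub> g x) x \<noteq> \<zero>\<^bsub>R\<^esub>} = {x \<in> X. f x \<oplus>\<^bsub>R\<^esub> g x \<noteq> \<zero>\<^bsub>R\<^esub>}"
      by auto
    ultimately show ?thesis
      using that by (auto simp: free_module_def PiE_iff)
  qed
  have smult: "(\<lambda>x\<in>X. r \<otimes>\<^bsub>R\<^esub> f x) \<in> carrier (free_module R X)"
    if "r \<in> carrier R" "f \<in> carrier (free_module R X)" for r f
  proof -
    have "finite {x \<in> X. f x \<noteq> \<zero>\<^bsub>R\<^esub>}"
      using that by (simp add: free_module_def)
    then have "finite {x \<in> X. (\<lambda>x\<in>X. r \<otimes>\<^bsub>R\<^esub> f x) x \<noteq> \<zero>\<^bsub>R\<^esub>}"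
      by (rule rev_finite_subset) (use that in \<open>auto simp: free_module_def\<close>)
    then show ?thesis
      using that by (auto simp: free_module_def PiE_iff)
  qed
  have mem: "f x \<in> carrier R" if "f \<in> carrier (free_module R X)" "x \<in> X" for f x
    using that by (auto simp: free_module_def)
  have ext: "f x = undefined" if "f \<in> carrier (free_module R X)" "x \<notin> X" for f x
    using that by (auto simp: free_module_def)
  have ops: "f \<oplus>\<^bsub>free_module R X\<^esub> g = (\<lambda>x\<in>X. f x \<oplus>\<^bsub>R\<^esub> g x)"
    "r \<odot>\<^bsub>free_module R X\<^esub> f = (\<lambda>x\<in>X. r \<otimes>\<^bsub>R\<^esub> f x)"
    "\<zero>\<^bsub>free_module R X\<^esub> = (\<lambda>x\<in>X. \<zero>\<^bsub>R\<^esub>)" for f g r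
    by (simp_all add: free_module_def)
  have zero: "(\<lambda>x\<in>X. \<zero>\<^bsub>R\<^esub>) \<in> carrier (free_module R X)"
    by (auto simp: free_module_def)
  show ?thesis
  proof (rule moduleI)
    show "abelian_group (free_module R X)"
    proof (rule abelian_groupI)
      fix f assume f: "f \<in> carrier (free_module R X)"
      have "(\<lambda>x\<in>X. (\<ominus>\<^bsub>R\<^esub> \<one>\<^bsub>R\<^esub>) \<otimes>\<^bsub>R\<^esub> f x) \<oplus>\<^bsub>free_module R X\<^esub> f = \<zero>\<^bsub>free_module R X\<^esub>"
        using mem[OF f] by (auto simp: ops l_minus l_neg)
      then show "\<exists>g\<in>carrier (free_module R X). g \<oplus>\<^bsub>free_module R X\<^esub> f = \<zero>\<^bsub>free_module R X\<^esub>"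
        using smult f by blast
      show "\<zero>\<^bsub>free_module R X\<^esub> \<oplus>\<^bsub>free_module R X\<^esub> f = f"
        using mem[OF f] ext[OF f] by (auto simp: ops)
    qed (auto simp: ops add zero mem a_ac)
  qed (auto simp: ops smult mem ext assms l_distr r_distr m_assoc)
qed

context module
begin

text \<open>The sum over the support may be extended to any finite set that contains it; this puts two
  elements of the free module on a common index set.\<close>
lemma free_cover_eq:
  assumes f: "f \<in> carrier (free_module R (carrier M))"
    and T: "finite T" "{x \<in> carrier M. f x \<noteq> \<zero>} \<subseteq> T" "T \<subseteq> carrier M"
  shows "free_cover R M f = (\<Oplus>\<^bsub>M\<^esub>x\<in>T. f x \<odot>\<^bsub>M\<^esub> x)"
  unfolding free_cover_def
proof (rule M.add.finprod_mono_neutral_cong_left)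
  show "(\<lambda>x. f x \<odot>\<^bsub>M\<^esub> x) \<in> T \<rightarrow> carrier M"
    using f T by (auto simp: free_module_def)
qed (use T f in \<open>auto simp: subset_eq\<close>)

lemma free_cover_closed:
  assumes "f \<in> carrier (free_module R (carrier M))"
  shows "free_cover R M f \<in> carrier M"
  unfolding free_cover_def using assms by (intro M.finsum_closed) (auto simp: free_module_def)

lemma free_cover_add:
  assumes f: "f \<in> carrier (free_module R (carrier M))" and g: "g \<in> carrier (free_module R (carrier M))"
  shows "free_cover R M (f \<oplus>\<^bsub>free_module R (carrier M)\<^esub> g) = free_cover R M f \<oplus>\<^bsub>M\<^esub> free_cover R M g"
proof -
  let ?T = "{x \<in> carrier M. f x \<noteq> \<zero>} \<union> {x \<in> carrier M. g x \<noteq> \<zero>}"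
  let ?h = "f \<oplus>\<^bsub>free_module R (carrier M)\<^esub> g"
  have fin: "finite ?T"
    using f g by (simp add: free_module_def)
  have fg: "f x \<in> carrier R" "g x \<in> carrier R" if "x \<in> carrier M" for x
    using f g that by (auto simp: free_module_def)
  interpret F: module R "free_module R (carrier M)"
    by (rule module_free) (rule R.is_cring)
  have h: "?h x = f x \<oplus> g x" if "x \<in> carrier M" for x
    using that by (simp add: free_module_def)
  have "free_cover R M ?h = (\<Oplus>\<^bsub>M\<^esub>x\<in>?T. ?h x \<odot>\<^bsub>M\<^esub> x)"
    using f g fin fg by (intro free_cover_eq) (auto simp: h)
  also have "\<dots> = (\<Oplus>\<^bsub>M\<^esub>x\<in>?T. f x \<odot>\<^bsub>M\<^esub> x \<oplus>\<^bsub>M\<^esub> g x \<odot>\<^bsub>M\<^esub> x)"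
    using fg by (intro M.finsum_cong') (auto simp: h smult_l_distr)
  also have "\<dots> = (\<Oplus>\<^bsub>M\<^esub>x\<in>?T. f x \<odot>\<^bsub>M\<^esub> x) \<oplus>\<^bsub>M\<^esub> (\<Oplus>\<^bsub>M\<^esub>x\<in>?T. g x \<odot>\<^bsub>M\<^esub> x)"
    using fg by (intro M.finsum_addf) auto
  also have "\<dots> = free_cover R M f \<oplus>\<^bsub>M\<^esub> free_cover R M g"
    using f g fin by (subst (1 2) free_cover_eq[where T = ?T]) auto
  finally show ?thesis .
qed

lemma free_cover_smult:
  assumes r: "r \<in> carrier R" and f: "f \<in> carrier (free_module R (carrier M))"
  shows "free_cover R M (r \<odot>\<^bsub>free_module R (carrier M)\<^esub> f) = r \<odot>\<^bsub>M\<^esub> free_cover R M f"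
proof -
  let ?T = "{x \<in> carrier M. f x \<noteq> \<zero>}"
  let ?h = "r \<odot>\<^bsub>free_module R (carrier M)\<^esub> f"
  have fin: "finite ?T"
    using f by (simp add: free_module_def)
  have fx: "f x \<in> carrier R" if "x \<in> carrier M" for x
    using f that by (auto simp: free_module_def)
  interpret F: module R "free_module R (carrier M)"
    by (rule module_free) (rule R.is_cring)
  have h: "?h x = r \<otimes> f x" if "x \<in> carrier M" for x
    using that by (simp add: free_module_def)
  have "free_cover R M ?h = (\<Oplus>\<^bsub>M\<^esub>x\<in>?T. ?h x \<odot>\<^bsub>M\<^esub> x)"
    using f r fin by (intro free_cover_eq) (auto simp: h)
  also have "\<dots> = (\<Oplus>\<^bsub>M\<^esub>x\<in>?T. r \<odot>\<^bsub>M\<^esub> (f x \<odot>\<^bsub>M\<^esub> x))"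
    using fx r by (intro M.finsum_cong') (auto simp: h smult_assoc1)
  also have "\<dots> = r \<odot>\<^bsub>M\<^esub> free_cover R M f"
    unfolding free_cover_def using fx r fin by (intro finsum_smult_ldistr[symmetric]) auto
  finally show ?thesis .
qed

lemma unit_vector:
  assumes "u \<in> carrier M"
  shows "(\<lambda>x\<in>carrier M. if x = u then \<one> else \<zero>) \<in> carrier (free_module R (carrier M))"
    and "free_cover R M (\<lambda>x\<in>carrier M. if x = u then \<one> else \<zero>) = u"
proof -
  let ?e = "\<lambda>x\<in>carrier M. if x = u then \<one> else \<zero>"
  have "finite {x \<in> carrier M. ?e x \<noteq> \<zero>}"
    by (rule finite_subset[of _ "{u}"]) auto
  then show e: "?e \<in> carrier (free_module R (carrier M))"
    by (auto simp: free_module_def)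
  have "free_cover R M ?e = (\<Oplus>\<^bsub>M\<^esub>x\<in>{u}. ?e x \<odot>\<^bsub>M\<^esub> x)"
    using assms by (intro free_cover_eq[OF e]) auto
  then show "free_cover R M ?e = u"
    using assms by simp
qed

lemma syzygy_mem_iff:
  "f \<in> carrier (syzygy_module R M)
    \<longleftrightarrow> f \<in> carrier (free_module R (carrier M)) \<and> free_cover R M f = \<zero>\<^bsub>M\<^esub>"
  by (simp add: syzygy_module_def)

lemma syzygy_ops:
  "add (syzygy_module R M) = add (free_module R (carrier M))"
  "smult (syzygy_module R M) = smult (free_module R (carrier M))"
  by (simp_all add: syzygy_module_def)

lemma module_syzygy: "module R (syzygy_module R M)"
proof -
  interpret F: module R "free_module R (carrier M)"
    by (rule module_free) (rule R.is_cring)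
  have "free_cover R M \<zero>\<^bsub>free_module R (carrier M)\<^esub> = \<zero>\<^bsub>M\<^esub>"
    using free_cover_smult[OF R.zero_closed F.zero_closed]
      free_cover_closed[OF F.zero_closed] by simp
  then have "submodule R {f \<in> carrier (free_module R (carrier M)). free_cover R M f = \<zero>\<^bsub>M\<^esub>}
      (free_module R (carrier M))"
    using F.module_axioms by (auto simp: submodule_def free_cover_add free_cover_smult)
  then show ?thesis
    unfolding syzygy_module_def by (rule F.submodule_is_module)
qed

end

lemma submodule_restricted_homs:
  assumes "module R M" "module R N"
  shows "submodule R ((\<lambda>f. restrict f (carrier (syzygy_module R M))) `
        carrier (hom_module R (free_module R (carrier M)) N))
      (hom_module R (syzygy_module R M) N)"
proof -
  interpret M: module R M by fact
  interpret N: module R N by fact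
  let ?F = "free_module R (carrier M)" and ?K = "syzygy_module R M"
  let ?H = "(\<lambda>f. restrict f (carrier ?K)) ` carrier (hom_module R ?F N)"
  interpret F: module R ?F
    by (rule module_free) (rule M.R.is_cring)
  interpret K: module R ?K
    by (rule M.module_syzygy)
  interpret HF: module R "hom_module R ?F N"
    by (intro module_hom_module F.module_axioms assms)
  interpret HK: module R "hom_module R ?K N"
    by (intro module_hom_module K.module_axioms assms)
  have sub: "carrier ?K \<subseteq> carrier ?F"
    by (auto simp: M.syzygy_mem_iff)
  have add: "restrict (f \<oplus>\<^bsub>hom_module R ?F N\<^esub> g) (carrier ?K)
      = restrict f (carrier ?K) \<oplus>\<^bsub>hom_module R ?K N\<^esub> restrict g (carrier ?K)" for f g
    by (rule ext) (use sub in \<open>auto simp: hom_module_def\<close>)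
  have smult: "restrict (r \<odot>\<^bsub>hom_module R ?F N\<^esub> f) (carrier ?K)
      = r \<odot>\<^bsub>hom_module R ?K N\<^esub> restrict f (carrier ?K)" for r f
    by (rule ext) (use sub in \<open>auto simp: hom_module_def\<close>)
  have zero: "\<zero>\<^bsub>hom_module R ?K N\<^esub> = restrict \<zero>\<^bsub>hom_module R ?F N\<^esub> (carrier ?K)"
    by (rule ext) (use sub in \<open>auto simp: hom_module_def\<close>)
  have "restrict f (carrier ?K) \<in> carrier (hom_module R ?K N)"
    if f: "f \<in> carrier (hom_module R ?F N)" for f
    using f sub K.M.add.m_closed K.smult_closed
    by (auto simp: hom_module_def module_hom_def M.syzygy_ops Pi_iff subset_eq)
  then show ?thesis
    unfolding submodule_def
  proof (intro conjI allI impI)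
    show "\<zero>\<^bsub>hom_module R ?K N\<^esub> \<in> ?H"
      unfolding zero by (rule imageI) (rule HF.zero_closed)
    show "v \<oplus>\<^bsub>hom_module R ?K N\<^esub> w \<in> ?H" if "v \<in> ?H" "w \<in> ?H" for v w
      using that HF.a_closed by (auto simp flip: add)
    show "c \<odot>\<^bsub>hom_module R ?K N\<^esub> v \<in> ?H" if "c \<in> carrier R" "v \<in> ?H" for c v
      using that HF.smult_closed by (auto simp flip: smult)
  qed (auto intro: HK.module_axioms)
qed

section \<open>The type of a semigroup ring\<close>

context numerical_semigroup
begin

context
  fixes coefficient_field :: "'k::field itself"
begin

(* With the coefficient type fixed, all modules below have one type each, and they can be
   interpreted as modules once and for all. *)
abbreviation ring_A :: "'k fls ring" where
  "ring_A \<equiv> R"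

abbreviation mod_A :: "('k fls, 'k fls) module" where
  "mod_A \<equiv> regular_module ring_A"

abbreviation residue :: "('k fls, 'k fls set) module" where
  "residue \<equiv> quotient_module mod_A M"

abbreviation free :: "('k fls, 'k fls set \<Rightarrow> 'k fls) module" where
  "free \<equiv> free_module ring_A (carrier residue)"

abbreviation syzygy :: "('k fls, 'k fls set \<Rightarrow> 'k fls) module" where
  "syzygy \<equiv> syzygy_module ring_A residue"

abbreviation homs :: "('k fls, ('k fls set \<Rightarrow> 'k fls) \<Rightarrow> 'k fls) module" where
  "homs \<equiv> hom_module ring_A syzygy mod_A"

abbreviation restricted :: "(('k fls set \<Rightarrow> 'k fls) \<Rightarrow> 'k fls) set" where
  "restricted \<equiv> (\<lambda>f. restrict f (carrier syzygy)) ` carrier (hom_module ring_A free mod_A)"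

lemma mod_A_simps [simp]:
  "carrier mod_A = A" "add mod_A = (+)" "zero mod_A = 0" "smult mod_A = (*)"
  by (simp_all add: regular_module_def)

interpretation mod_A: module ring_A mod_A
  by (rule module_regular[OF cring_R])

lemma submodule_M: "submodule ring_A M mod_A"
  using mod_A.module_axioms M_subset M_mult
  by (auto simp: submodule_def intro: supported_add)

interpretation residue: quotient_by_submodule ring_A mod_A M
  by (rule quotient_by_submodule.intro[OF mod_A.module_axioms
    quotient_by_submodule_axioms.intro[OF submodule_M]])

interpretation res: module ring_A residue
  by (rule residue.module_quotient)

interpretation free: module ring_A free
  by (rule module_free[OF cring_R])

interpretation syzygy: module ring_A syzygy
  by (rule res.module_syzygy)

interpretation homs: module ring_A homs
  by (rule module_hom_module[OF syzygy.module_axioms mod_A.module_axioms])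

interpretation ext: quotient_by_submodule ring_A homs restricted
  by (rule quotient_by_submodule.intro[OF homs.module_axioms
    quotient_by_submodule_axioms.intro[OF
      submodule_restricted_homs[OF res.module_axioms mod_A.module_axioms]]])

text \<open>The residue class of 1, over which the basis vector \<open>unit_one\<close> of the free cover lies.\<close>
definition one_class :: "'k fls set" where
  "one_class = M +>\<^bsub>mod_A\<^esub> 1"

definition unit_one :: "'k fls set \<Rightarrow> 'k fls" where
  "unit_one = (\<lambda>x\<in>carrier residue. if x = one_class then \<one>\<^bsub>ring_A\<^esub> else \<zero>\<^bsub>ring_A\<^esub>)"

lemma one_class: "one_class \<in> carrier residue"
  unfolding one_class_def residue.carrier_quotient by (rule imageI) (simp add: A_one)

lemma unit_one: "unit_one \<in> carrier free" "free_cover ring_A residue unit_one = one_class"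
  unfolding unit_one_def using res.unit_vector[OF one_class] by auto

text \<open>The maximal ideal annihilates the residue field.\<close>
lemma M_scales_into_syzygy:
  assumes "x \<in> M" "a \<in> carrier free"
  shows "x \<odot>\<^bsub>free\<^esub> a \<in> carrier syzygy"
proof -
  have x: "x \<in> carrier ring_A"
    using assms M_subset by auto
  obtain s where s: "s \<in> A" "free_cover ring_A residue a = M +>\<^bsub>mod_A\<^esub> s"
    using res.free_cover_closed[OF assms(2)] unfolding residue.carrier_quotient by auto
  have "free_cover ring_A residue (x \<odot>\<^bsub>free\<^esub> a) = M +>\<^bsub>mod_A\<^esub> (s * x)"
    using x s assms by (simp add: res.free_cover_smult residue.smult_quotient mult.commute)
  also have "\<dots> = M"
    using M_mult[OF s(1) assms(1)] M_subset residue.coset_eq_iff[of "s * x"] by auto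
  finally show ?thesis
    using x assms by (simp add: res.syzygy_mem_iff residue.zero_quotient)
qed

lemma hom_closed: "\<phi> \<in> carrier homs \<Longrightarrow> a \<in> carrier syzygy \<Longrightarrow> \<phi> a \<in> A"
  and hom_add: "\<phi> \<in> carrier homs \<Longrightarrow> a \<in> carrier syzygy \<Longrightarrow> b \<in> carrier syzygy
    \<Longrightarrow> \<phi> (a \<oplus>\<^bsub>free\<^esub> b) = \<phi> a + \<phi> b"
  and hom_smult: "\<phi> \<in> carrier homs \<Longrightarrow> r \<in> A \<Longrightarrow> a \<in> carrier syzygy
    \<Longrightarrow> \<phi> (r \<odot>\<^bsub>free\<^esub> a) = r * \<phi> a"
  by (auto simp: hom_module_def module_hom_def res.syzygy_ops)

lemma syzygy_subset: "carrier syzygy \<subseteq> carrier free"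
  by (auto simp: res.syzygy_mem_iff)

text \<open>A nonzero element of \<open>M\<close> that is easy to divide by; it generates the conductor of \<open>A\<close> in
  \<open>k[[t]]\<close> as an ideal of \<open>k[[t]]\<close>.\<close>
definition conductor :: "'k fls" where
  "conductor = t_power (int F + 1)"

lemma conductor_in_M: "conductor \<in> M"
proof -
  have "F + 1 \<in> S - {0}"
    using beyond_frobenius by simp
  then show ?thesis
    unfolding conductor_def by (intro supported_t_power) (force intro: image_eqI[of _ _ "F + 1"])
qed

text \<open>The extension of a homomorphism \<open>\<phi>\<close> from the syzygy module to the free cover, with values in the
  field of fractions: \<open>\<phi>(xa)/x\<close> with \<open>x\<close> the conductor element.\<close>
definition lift :: "(('k fls set \<Rightarrow> 'k fls) \<Rightarrow> 'k fls) \<Rightarrow> ('k fls set \<Rightarrow> 'k fls) \<Rightarrow> 'k fls" where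
  "lift \<phi> a = t_power (- (int F + 1)) * \<phi> (conductor \<odot>\<^bsub>free\<^esub> a)"

lemma lift_add:
  assumes "\<phi> \<in> carrier homs" "a \<in> carrier free" "b \<in> carrier free"
  shows "lift \<phi> (a \<oplus>\<^bsub>free\<^esub> b) = lift \<phi> a + lift \<phi> b"
proof -
  have "conductor \<odot>\<^bsub>free\<^esub> (a \<oplus>\<^bsub>free\<^esub> b) = conductor \<odot>\<^bsub>free\<^esub> a \<oplus>\<^bsub>free\<^esub> conductor \<odot>\<^bsub>free\<^esub> b"
    using conductor_in_M M_subset assms by (intro free.smult_r_distr) auto
  then show ?thesis
    unfolding lift_def using assms conductor_in_M
    by (simp add: hom_add M_scales_into_syzygy distrib_left)
qed

lemma lift_smult:
  assumes "\<phi> \<in> carrier homs" "r \<in> A" "a \<in> carrier free"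
  shows "lift \<phi> (r \<odot>\<^bsub>free\<^esub> a) = r * lift \<phi> a"
proof -
  have "conductor \<odot>\<^bsub>free\<^esub> (r \<odot>\<^bsub>free\<^esub> a) = (conductor \<otimes>\<^bsub>ring_A\<^esub> r) \<odot>\<^bsub>free\<^esub> a"
    using conductor_in_M M_subset assms by (intro free.smult_assoc1[symmetric]) auto
  also have "\<dots> = (r \<otimes>\<^bsub>ring_A\<^esub> conductor) \<odot>\<^bsub>free\<^esub> a"
    by (simp add: mult.commute)
  also have "\<dots> = r \<odot>\<^bsub>free\<^esub> (conductor \<odot>\<^bsub>free\<^esub> a)"
    using conductor_in_M M_subset assms by (intro free.smult_assoc1) auto
  finally show ?thesis
    unfolding lift_def using assms conductor_in_M
    by (simp add: hom_smult M_scales_into_syzygy mult.left_commute)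
qed

lemma lift_extends:
  assumes "\<phi> \<in> carrier homs" "a \<in> carrier syzygy"
  shows "lift \<phi> a = \<phi> a"
proof -
  have "\<phi> (conductor \<odot>\<^bsub>free\<^esub> a) = conductor * \<phi> a"
    using assms conductor_in_M M_subset by (intro hom_smult) auto
  then show ?thesis
    unfolding lift_def by (simp add: conductor_def t_power_cancel del: minus_add_distrib)
qed

lemma M_mult_lift:
  assumes "\<phi> \<in> carrier homs" "x \<in> M" "a \<in> carrier free"
  shows "x * lift \<phi> a \<in> A"
proof -
  have syz: "x \<odot>\<^bsub>free\<^esub> a \<in> carrier syzygy"
    using M_scales_into_syzygy assms(2,3) .
  have "x * lift \<phi> a = lift \<phi> (x \<odot>\<^bsub>free\<^esub> a)"
    using lift_smult[OF assms(1) subsetD[OF M_subset assms(2)] assms(3)] by (rule sym)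
  also have "\<dots> = \<phi> (x \<odot>\<^bsub>free\<^esub> a)"
    using assms(1) syz by (rule lift_extends)
  also have "\<dots> \<in> A"
    using assms(1) syz by (rule hom_closed)
  finally show ?thesis .
qed

text \<open>An exponent \<open>z\<close> of the lift satisfies \<open>z + s \<in> S\<close> for all \<open>s \<in> S - {0}\<close>, since \<open>t\<^sup>s\<close> multiplies the
  lift into \<open>A\<close>. A negative \<open>z\<close> is impossible, as \<open>s = F - z > F\<close> would give \<open>F \<in> S\<close>.\<close>
lemma lift_support:
  assumes "\<phi> \<in> carrier homs" "a \<in> carrier free"
  shows "lift \<phi> a \<in> supported (int ` (S \<union> pseudo_frobenius S))"
proof (rule supportedI)
  fix z
  assume z: "lift \<phi> a $$ z \<noteq> 0"
  have shift: "z + int s \<in> int ` S" if "s \<in> S" "s \<noteq> 0" for s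
  proof -
    have "t_power (int s) * lift \<phi> a \<in> A"
      using that by (intro M_mult_lift assms supported_t_power) auto
    then show ?thesis
      by (rule supportedD) (use z in \<open>simp add: t_power_mult_nth\<close>)
  qed
  have "0 \<le> z"
  proof (rule ccontr)
    assume "\<not> 0 \<le> z"
    then have "z + int (F + nat (- z)) \<in> int ` S"
      by (intro shift beyond_frobenius) auto
    moreover have "z + int (F + nat (- z)) = int F"
      using \<open>\<not> 0 \<le> z\<close> by simp
    ultimately show False
      using frobenius_gap by auto
  qed
  then obtain d where d: "z = int d"
    by (metis nat_0_le)
  have "d + s \<in> S" if "s \<in> S" "s \<noteq> 0" for s
    using shift[OF that] unfolding d by (metis image_iff of_nat_add of_nat_eq_iff)
  then show "z \<in> int ` (S \<union> pseudo_frobenius S)"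
    unfolding d pseudo_frobenius_def by auto
qed

text \<open>Modulo the syzygy module, where the lift is \<open>\<phi>\<close> itself, every element of the free cover is a
  multiple of \<open>unit_one\<close>.\<close>
lemma lift_in_A:
  assumes "\<phi> \<in> carrier homs" "lift \<phi> unit_one \<in> A" "a \<in> carrier free"
  shows "lift \<phi> a \<in> A"
proof -
  obtain s where s: "s \<in> A" "free_cover ring_A residue a = M +>\<^bsub>mod_A\<^esub> s"
    using res.free_cover_closed[OF assms(3)] unfolding residue.carrier_quotient by auto
  define b where "b = a \<oplus>\<^bsub>free\<^esub> (- s) \<odot>\<^bsub>free\<^esub> unit_one"
  have ms: "- s \<in> carrier ring_A"
    using s by (simp add: supported_uminus)
  then have scaled: "(- s) \<odot>\<^bsub>free\<^esub> unit_one \<in> carrier free"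
    using unit_one by simp
  have "free_cover ring_A residue ((- s) \<odot>\<^bsub>free\<^esub> unit_one) = M +>\<^bsub>mod_A\<^esub> (- s)"
    using ms unit_one
    by (simp add: res.free_cover_smult one_class_def residue.smult_quotient A_one)
  then have "free_cover ring_A residue b = M +>\<^bsub>mod_A\<^esub> (s + - s)"
    unfolding b_def using ms s scaled assms(3)
    by (simp add: res.free_cover_add residue.add_quotient del: add.right_inverse)
  also have "\<dots> = M"
    using residue.coset_eq_iff[of 0] by simp
  finally have "b \<in> carrier syzygy"
    using scaled assms(3) by (simp add: res.syzygy_mem_iff residue.zero_quotient b_def)
  then have "lift \<phi> b \<in> A"
    using lift_extends hom_closed assms by simp
  moreover have "lift \<phi> b = lift \<phi> a + (- s) * lift \<phi> unit_one"
    unfolding b_def using assms scaled ms unit_one by (simp add: lift_add lift_smult)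
  ultimately have "lift \<phi> b + s * lift \<phi> unit_one \<in> A"
    using s assms A_mult supported_add by blast
  then show ?thesis
    using \<open>lift \<phi> b = _\<close> by simp
qed

lemma restricted_if_lift_in_A:
  assumes "\<phi> \<in> carrier homs" "lift \<phi> unit_one \<in> A"
  shows "\<phi> \<in> restricted"
proof
  show "restrict (lift \<phi>) (carrier free) \<in> carrier (hom_module ring_A free mod_A)"
    using lift_in_A[OF assms] lift_add[OF assms(1)] lift_smult[OF assms(1)]
    by (auto simp: hom_module_def module_hom_def)
  have "\<phi> \<in> extensional (carrier syzygy)"
    using assms(1) by (simp add: hom_module_def)
  then show "\<phi> = restrict (restrict (lift \<phi>) (carrier free)) (carrier syzygy)"
    using syzygy_subset lift_extends[OF assms(1)]
    by (intro extensionalityI[of _ "carrier syzygy"]) auto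
qed

lemma lift_hom_add:
  assumes "a \<in> carrier free"
  shows "lift (\<phi> \<oplus>\<^bsub>homs\<^esub> \<psi>) a = lift \<phi> a + lift \<psi> a"
  using M_scales_into_syzygy[OF conductor_in_M assms]
  by (simp add: lift_def hom_module_def distrib_left)

lemma lift_hom_smult:
  assumes "a \<in> carrier free"
  shows "lift (r \<odot>\<^bsub>homs\<^esub> \<phi>) a = r * lift \<phi> a"
  using M_scales_into_syzygy[OF conductor_in_M assms]
  by (simp add: lift_def hom_module_def mult.left_commute)

abbreviation ext_space :: "('k, (('k fls set \<Rightarrow> 'k fls) \<Rightarrow> 'k fls) set) module" where
  "ext_space \<equiv> restrict_scalars fls_const (Ext1 ring_A residue mod_A)"

abbreviation cls :: "(('k fls set \<Rightarrow> 'k fls) \<Rightarrow> 'k fls) \<Rightarrow> (('k fls set \<Rightarrow> 'k fls) \<Rightarrow> 'k fls) set" where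
  "cls \<phi> \<equiv> restricted +>\<^bsub>homs\<^esub> \<phi>"

lemma ext_space_simps:
  "carrier ext_space = cls ` carrier homs"
  "\<zero>\<^bsub>ext_space\<^esub> = restricted"
  "\<phi> \<in> carrier homs \<Longrightarrow> \<psi> \<in> carrier homs \<Longrightarrow> cls \<phi> \<oplus>\<^bsub>ext_space\<^esub> cls \<psi> = cls (\<phi> \<oplus>\<^bsub>homs\<^esub> \<psi>)"
  "\<phi> \<in> carrier homs \<Longrightarrow> c \<odot>\<^bsub>ext_space\<^esub> cls \<phi> = cls (fls_const c \<odot>\<^bsub>homs\<^esub> \<phi>)"
  by (simp_all add: A_const restrict_scalars_def Ext1_def ext.carrier_quotient
    ext.zero_quotient ext.add_quotient ext.smult_quotient)

interpretation ext_space: vectorspace "type_ring :: 'k ring" ext_space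
proof (rule vectorspace.intro)
  show "field (type_ring :: 'k ring)"
    by (rule field_type_ring)
  have "module ring_A (Ext1 ring_A residue mod_A)"
    unfolding Ext1_def by (rule ext.module_quotient)
  then show "module (type_ring :: 'k ring) ext_space"
    using field.axioms(1)[OF field_type_ring, THEN domain.axioms(1)]
    by (intro module_restrict_scalars[where R = ring_A])
      (auto simp: fls_plus_const A_const)
qed

text \<open>Gaussian elimination on the coefficients of the lifts at the exponents in \<open>P\<close>: one homomorphism
  with nonzero coefficient at \<open>f\<close> clears this coefficient from all others. If none exists, \<open>f\<close> can be
  dropped. When no exponent outside \<open>S\<close> is left, the class is zero.\<close>
lemma Ext1_spanned:
  assumes "finite P"
  shows "\<exists>B. finite B \<and> B \<subseteq> carrier homs \<and> card B \<le> card P \<and>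
    (\<forall>\<phi>\<in>carrier homs. lift \<phi> unit_one \<in> supported (int ` (S \<union> P))
      \<longrightarrow> cls \<phi> \<in> ext_space.span (cls ` B))"
  using assms
proof (induction P rule: finite_induct)
  case empty
  have "\<forall>\<phi>\<in>carrier homs. lift \<phi> unit_one \<in> supported (int ` (S \<union> {}))
      \<longrightarrow> cls \<phi> \<in> ext_space.span (cls ` {})"
  proof (intro ballI impI)
    fix \<phi>
    assume "\<phi> \<in> carrier homs" "lift \<phi> unit_one \<in> supported (int ` (S \<union> {}))"
    then have "cls \<phi> = \<zero>\<^bsub>ext_space\<^esub>"
      using restricted_if_lift_in_A[of \<phi>] by (simp add: ext_space_simps ext.coset_eq_iff)
    moreover have "\<zero>\<^bsub>ext_space\<^esub> \<in> ext_space.span {}"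
      using ext_space.span_is_submodule[of "{}"] by (simp add: submodule_def)
    ultimately show "cls \<phi> \<in> ext_space.span (cls ` {})"
      by (simp only: image_empty)
  qed
  then show ?case
    by (intro exI[of _ "{}"] conjI) (assumption | simp)+
next
  case (insert f P)
  then obtain B where B: "finite B" "B \<subseteq> carrier homs" "card B \<le> card P"
    and span: "\<And>\<phi>. \<phi> \<in> carrier homs \<Longrightarrow> lift \<phi> unit_one \<in> supported (int ` (S \<union> P))
      \<Longrightarrow> cls \<phi> \<in> ext_space.span (cls ` B)"
    by blast
  have drop: "x \<in> supported (int ` (S \<union> P))"
    if "x \<in> supported (int ` (S \<union> insert f P))" "x $$ int f = 0" for x :: "'k fls"
  proof (rule supportedI)
    fix z
    assume "x $$ z \<noteq> 0"
    then show "z \<in> int ` (S \<union> P)"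
      using supportedD[OF that(1), of z] that(2) by auto
  qed
  show ?case
  proof (cases "\<exists>\<psi>\<in>carrier homs. lift \<psi> unit_one \<in> supported (int ` (S \<union> insert f P))
      \<and> lift \<psi> unit_one $$ int f \<noteq> 0")
    case False
    then have "\<forall>\<phi>\<in>carrier homs. lift \<phi> unit_one \<in> supported (int ` (S \<union> insert f P))
        \<longrightarrow> cls \<phi> \<in> ext_space.span (cls ` B)"
      using span drop by blast
    moreover have "card B \<le> card (insert f P)"
      using B insert by simp
    ultimately show ?thesis
      using B by blast
  next
    case True
    then obtain \<psi> where \<psi>: "\<psi> \<in> carrier homs"
      "lift \<psi> unit_one \<in> supported (int ` (S \<union> insert f P))" "lift \<psi> unit_one $$ int f \<noteq> 0"
      by blast
    have sub: "cls ` insert \<psi> B \<subseteq> carrier ext_space"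
      using B \<psi> by (auto simp: ext_space_simps)
    have "cls \<phi> \<in> ext_space.span (cls ` insert \<psi> B)"
      if \<phi>: "\<phi> \<in> carrier homs" "lift \<phi> unit_one \<in> supported (int ` (S \<union> insert f P))" for \<phi>
    proof -
      define c where "c = lift \<phi> unit_one $$ int f / lift \<psi> unit_one $$ int f"
      \<comment> \<open>The coefficient of the lift at \<open>f\<close> is cleared.\<close>
      define \<chi> where "\<chi> = \<phi> \<oplus>\<^bsub>homs\<^esub> (fls_const (- c) \<odot>\<^bsub>homs\<^esub> \<psi>)"
      have \<chi>: "\<chi> \<in> carrier homs"
        unfolding \<chi>_def using \<phi> \<psi> by (simp add: A_const supported_uminus)
      have eq: "lift \<chi> unit_one = lift \<phi> unit_one + fls_const (- c) * lift \<psi> unit_one"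
        unfolding \<chi>_def using unit_one by (simp add: lift_hom_add lift_hom_smult)
      have "fls_const (- c) * lift \<psi> unit_one \<in> supported (int ` (S \<union> insert f P))"
        by (rule supported_mult[OF supported_const[of "{0}"] \<psi>(2)]) auto
      then have "lift \<chi> unit_one \<in> supported (int ` (S \<union> insert f P))"
        unfolding eq using \<phi> by (intro supported_add)
      moreover have "lift \<chi> unit_one $$ int f = 0"
        unfolding eq using \<psi>(3) by (simp add: c_def)
      ultimately have "cls \<chi> \<in> ext_space.span (cls ` B)"
        using \<chi> span drop by blast
      then have "cls \<chi> \<in> ext_space.span (cls ` insert \<psi> B)"
        using ext_space.span_is_monotone[of "cls ` B" "cls ` insert \<psi> B"] by auto
      then have "cls \<chi> \<oplus>\<^bsub>ext_space\<^esub> c \<odot>\<^bsub>ext_space\<^esub> cls \<psi> \<in> ext_space.span (cls ` insert \<psi> B)"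
        by (intro ext_space.span_contains_combination[OF sub]) auto
      also have "cls \<chi> \<oplus>\<^bsub>ext_space\<^esub> c \<odot>\<^bsub>ext_space\<^esub> cls \<psi> = cls (\<chi> \<oplus>\<^bsub>homs\<^esub> fls_const c \<odot>\<^bsub>homs\<^esub> \<psi>)"
        using \<chi> \<psi> by (simp add: ext_space_simps A_const)
      also have "\<chi> \<oplus>\<^bsub>homs\<^esub> fls_const c \<odot>\<^bsub>homs\<^esub> \<psi> = \<phi>"
      proof -
        have "\<chi> \<oplus>\<^bsub>homs\<^esub> fls_const c \<odot>\<^bsub>homs\<^esub> \<psi>
            = \<phi> \<oplus>\<^bsub>homs\<^esub> (fls_const (- c) \<oplus>\<^bsub>ring_A\<^esub> fls_const c) \<odot>\<^bsub>homs\<^esub> \<psi>"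
          unfolding \<chi>_def using \<phi> \<psi>
          by (subst homs.smult_l_distr) (auto simp: homs.M.a_assoc A_const supported_uminus)
        also have "fls_const (- c) \<oplus>\<^bsub>ring_A\<^esub> fls_const c = \<zero>\<^bsub>ring_A\<^esub>"
          by (simp add: fls_plus_const)
        finally show ?thesis
          using homs.smult_l_null[OF \<psi>(1)] homs.M.r_zero[OF \<phi>(1)] by simp
      qed
      finally show ?thesis .
    qed
    moreover have "card (insert \<psi> B) \<le> card (insert f P)"
      using B insert by (simp add: card_insert_if)
    moreover have "finite (insert \<psi> B)" "insert \<psi> B \<subseteq> carrier homs"
      using B \<psi> by simp_all
    ultimately show ?thesis
      by blast
  qed
qed

lemma finite_pseudo_frobenius: "finite (pseudo_frobenius S)"
proof (rule finite_subset)
  show "pseudo_frobenius S \<subseteq> {..F}"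
    unfolding pseudo_frobenius_def using beyond_frobenius by (auto simp: not_less[symmetric])
qed simp

theorem CM_type_le:
  "CM_type (type_ring :: 'k ring) fls_const ring_A \<le> enat (card (pseudo_frobenius S))"
proof -
  obtain B where B: "finite B" "B \<subseteq> carrier homs" "card B \<le> card (pseudo_frobenius S)"
    and span: "\<And>\<phi>. \<phi> \<in> carrier homs
      \<Longrightarrow> lift \<phi> unit_one \<in> supported (int ` (S \<union> pseudo_frobenius S))
      \<Longrightarrow> cls \<phi> \<in> ext_space.span (cls ` B)"
    using Ext1_spanned[OF finite_pseudo_frobenius] by blast
  have "vdim (type_ring :: 'k ring) ext_space \<le> enat (card (cls ` B))"
  proof (rule ext_space.vdim_le_card)
    show "finite (cls ` B)"
      using B by simp
    show "cls ` B \<subseteq> carrier ext_space"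
      using B by (auto simp: ext_space_simps)
    show "carrier ext_space \<subseteq> ext_space.span (cls ` B)"
      unfolding ext_space_simps using span lift_support unit_one by blast
  qed
  also have "\<dots> \<le> enat (card (pseudo_frobenius S))"
    using card_image_le[OF B(1), of cls] B(3) by simp
  finally show ?thesis
    unfolding CM_type_def max_ideal_R .
qed

end

end

section \<open>Monomial curves in affine four-space\<close>

theorem theorem1:
  fixes n :: "nat \<Rightarrow> nat"
  assumes "\<forall>i\<in>{1..4}. 0 < n i"
    and "Gcd (n ` {1..4}) = 1"
    and "minimal_generating_system n {1..4}"
    and "curve_almost_Gorenstein TYPE('k::field) n {1..4}"
  shows "curve_CM_type TYPE('k) n {1..4} \<le> 3"
proof -
  let ?I = "{1..4} :: nat set"
  let ?S = "generated_semigroup n ?I"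
  define F where "F = Max (- ?S)"
  have gaps: "finite (- ?S)" "- ?S \<noteq> {}"
    using generated_semigroup_cofinite[of ?I 1 n] one_not_in_generated_semigroup[of ?I n] assms
    by auto
  have "F \<in> - ?S"
    unfolding F_def using gaps by (rule Max_in)
  have large: "x \<in> ?S" if "F < x" for x
    using that Max_ge[OF gaps(1), of x] unfolding F_def by fastforce
  interpret numerical_semigroup ?S F
    using \<open>F \<in> - ?S\<close> large
    by unfold_locales (auto intro: generated_semigroup_zero generated_semigroup_add)
  have ring: "monomial_power_series n ?I = (supported (int ` ?S) :: 'k fls set)"
    using assms(1) by (intro monomial_power_series_eq) auto
  let ?P = "pseudo_frobenius ?S - {F}"
  have AG: "almost_Gorenstein (type_ring :: 'k fls ring) (supported (int ` ?S)) power_series"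
    using assms(4) unfolding curve_almost_Gorenstein_def ring .
  interpret symmetric_pseudo_frobenius n ?I ?P F
  proof
    show "f \<le> F" "F - f \<in> ?P" if "f \<in> ?P" for f
      using almost_Gorenstein_imp_symmetric[OF AG, of f] that by auto
  qed (use assms(1) \<open>F \<in> - ?S\<close> finite_pseudo_frobenius in auto)
  have "card (pseudo_frobenius ?S) \<le> card (insert F ?P)"
    using finite_pseudo_frobenius by (intro card_mono) auto
  also have "\<dots> \<le> 3"
    using card_le_2 by (intro card_insert_le_m1) auto
  finally have "enat (card (pseudo_frobenius ?S)) \<le> 3"
    by (simp add: numeral_eq_enat)
  then show ?thesis
    using CM_type_le[where 'k = 'k] unfolding curve_CM_type_def ring by (rule order_trans[rotated])
qed

end
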